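(* Let $(E_6)^{\lambda\gamma}=\{\alpha\in E_6\mid \lambda(\gamma\alpha\gamma)=\alpha\}$ and $(E_6)^{\lambda\gamma\sigma}=\{\alpha\in E_6\mid \lambda(\gamma\sigma\,\alpha\,\sigma\gamma)=\alpha\}$. Then $$(E_6)^{\lambda\gamma}\cap (E_6)^{\lambda\gamma\sigma}\;\cong\;\big((Sp(2)\times Sp(2))/\mathbf{Z}_2\big)\rtimes\mathcal{Z}_2,$$ where $\mathbf{Z}_2=\{(E,E),(-E,-E)\}$ and $\mathcal{Z}_2=\{1,\rho\}$ is a group of order $2$ acting through $\rho(A,B)=(B,A)$.
   Context: Let $\mathbf{H}$ be the quaternions and $\mathfrak{C}=\mathbf{H}\oplus\mathbf{H}e_4$ the division Cayley algebra with product $(m+ae_4)(n+be_4)=(mn-\overline{b}a)+(a\overline{n}+bm)e_4$. Let $\mathfrak{J}=\{X\in M(3,\mathfrak{C})\mid X^*=X\}$, with elements $X=\begin{pmatrix}\xi_1&x_3&\overline{x}_2\\ \overline{x}_3&\xi_2&x_1\\ x_2&\overline{x}_1&\xi_3\end{pmatrix}$, and let $\mathfrak{J}^C=\mathfrak{J}\oplus i\mathfrak{J}$ be its complexification ($C=\mathbf{R}\oplus\mathbf{R}i$), with $X\circ Y=\frac12(XY+YX)$, $(X,Y)=\mathrm{tr}(X\circ Y)$, $X\times Y=\frac12\big(2X\circ Y-\mathrm{tr}(X)Y-\mathrm{tr}(Y)X+(\mathrm{tr}(X)\mathrm{tr}(Y)-(X,Y))E\big)$, $\det X=\frac13(X,X\times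 X)$, complex conjugation $\tau(X+iY)=X-iY$ ($X,Y\in\mathfrak{J}$), and $\langle X,Y\rangle=(\tau X,Y)$. Then $E_6=\{\alpha\in\mathrm{Iso}_C(\mathfrak{J}^C)\mid \det\alpha X=\det X,\ \langle\alpha X,\alpha Y\rangle=\langle X,Y\rangle\}$. $\lambda$ is the involutive automorphism of $E_6$ given by $\lambda(\alpha)={}^t\alpha^{-1}=\tau\alpha\tau$ (transpose with respect to $(X,Y)$). The involutive elements $\gamma,\sigma\in E_6$ are the $C$-linear maps: $\gamma$ acts entrywise by $\gamma(x+ye_4)=x-ye_4$ ($x,y\in\mathbf{H}$); $\sigma$ keeps $\xi_1,\xi_2,\xi_3,x_1$ and replaces $x_2,x_3$ by $-x_2,-x_3$. $Sp(n)=\{A\in M(n,\mathbf{H})\mid AA^*=E\}$. The action of $\mathcal{Z}_2$ on $Sp(2)\times Sp(2)$ induces the action on the quotient. *)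

theory Defs
  imports "HOL-Analysis.Analysis" "HOL-Algebra.Coset"
begin

section \<open>Quaternions\<close>

datatype quat = Quat (q0: real) (q1: real) (q2: real) (q3: real)

lemma quat_eqI: "q0 x = q0 y \<Longrightarrow> q1 x = q1 y \<Longrightarrow> q2 x = q2 y \<Longrightarrow> q3 x = q3 y \<Longrightarrow> x = y"
  by (cases x; cases y) auto

instantiation quat :: ring_1
begin

definition zero_quat :: quat where "0 = Quat 0 0 0 0"

definition one_quat :: quat where "1 = Quat 1 0 0 0"

definition plus_quat :: "quat \<Rightarrow> quat \<Rightarrow> quat" where
  "x + y = Quat (q0 x + q0 y) (q1 x + q1 y) (q2 x + q2 y) (q3 x + q3 y)"

definition uminus_quat :: "quat \<Rightarrow> quat" where
  "- x = Quat (- q0 x) (- q1 x) (- q2 x) (- q3 x)"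

definition minus_quat :: "quat \<Rightarrow> quat \<Rightarrow> quat" where
  "x - y = Quat (q0 x - q0 y) (q1 x - q1 y) (q2 x - q2 y) (q3 x - q3 y)"

definition times_quat :: "quat \<Rightarrow> quat \<Rightarrow> quat" where
  "x * y = Quat
     (q0 x * q0 y - q1 x * q1 y - q2 x * q2 y - q3 x * q3 y)
     (q0 x * q1 y + q1 x * q0 y + q2 x * q3 y - q3 x * q2 y)
     (q0 x * q2 y - q1 x * q3 y + q2 x * q0 y + q3 x * q1 y)
     (q0 x * q3 y + q1 x * q2 y - q2 x * q1 y + q3 x * q0 y)"

lemmas quat_ring_defs =
  zero_quat_def one_quat_def plus_quat_def uminus_quat_def minus_quat_def times_quat_def

instance
  by standard (auto simp: quat_ring_defs algebra_simps)

end

instantiation quat :: real_vector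
begin

definition scaleR_quat :: "real \<Rightarrow> quat \<Rightarrow> quat" where
  "r *\<^sub>R x = Quat (r * q0 x) (r * q1 x) (r * q2 x) (r * q3 x)"

instance
  by standard (auto simp: scaleR_quat_def plus_quat_def algebra_simps)

end

instantiation quat :: real_normed_vector
begin

definition norm_quat :: "quat \<Rightarrow> real" where
  "norm x = norm (q0 x, q1 x, q2 x, q3 x)"

definition "sgn x = x /\<^sub>R norm x" for x :: quat

definition "dist x y = norm (x - y)" for x y :: quat

definition
  "(uniformity :: (quat \<times> quat) filter) = (INF e\<in>{0<..}. principal {(x, y). dist x y < e})"

definition
  "open (U :: quat set) \<longleftrightarrow> (\<forall>x\<in>U. eventually (\<lambda>(x', y). x' = x \<longrightarrow> y \<in> U) uniformity)"

instance
proof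
  fix x y :: quat and r :: real
  show "norm x = 0 \<longleftrightarrow> x = 0"
    by (cases x) (simp add: norm_quat_def zero_quat_def zero_prod_def)
  show "norm (x + y) \<le> norm x + norm y"
    using norm_triangle_ineq[of "(q0 x, q1 x, q2 x, q3 x)" "(q0 y, q1 y, q2 y, q3 y)"]
    by (simp add: norm_quat_def plus_quat_def)
  show "norm (r *\<^sub>R x) = \<bar>r\<bar> * norm x"
    using norm_scaleR[of r "(q0 x, q1 x, q2 x, q3 x)"]
    by (simp add: norm_quat_def scaleR_quat_def)
qed (simp_all add: sgn_quat_def dist_quat_def uniformity_quat_def open_quat_def)

end

definition qcnj :: "quat \<Rightarrow> quat" where
  "qcnj x = Quat (q0 x) (- q1 x) (- q2 x) (- q3 x)"

lemma qcnj_simps: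
  "qcnj 0 = 0" "qcnj (qcnj x) = x" "qcnj (x + y) = qcnj x + qcnj y" "qcnj (- x) = - qcnj x"
  "qcnj (x - y) = qcnj x - qcnj y" "qcnj (x * y) = qcnj y * qcnj x" "qcnj (r *\<^sub>R x) = r *\<^sub>R qcnj x"
  by (auto simp: qcnj_def quat_ring_defs scaleR_quat_def algebra_simps)

definition Sp :: "(quat^'n^'n) monoid" where
  "Sp = \<lparr>carrier = {A. A ** (\<chi> i j. qcnj (A$j$i)) = mat 1}, mult = (**), one = mat 1\<rparr>"


section \<open>Cayley numbers\<close>

text \<open>The pair \<open>(m, a)\<close> stands for \<open>m + a e\<^sub>4\<close>.\<close>

type_synonym cayley = "quat \<times> quat"

definition cmul :: "cayley \<Rightarrow> cayley \<Rightarrow> cayley" (infixl \<open>\<star>\<close> 70) where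
  "x \<star> y = (case (x, y) of ((m, a), (n, b)) \<Rightarrow> (m * n - qcnj b * a, a * qcnj n + b * m))"

definition ccnj :: "cayley \<Rightarrow> cayley" where
  "ccnj x = (qcnj (fst x), - snd x)"

definition cRe :: "cayley \<Rightarrow> real" where
  "cRe x = q0 (fst x)"

lemma ccnj_simps:
  "ccnj 0 = 0" "ccnj (ccnj x) = x" "ccnj (x + y) = ccnj x + ccnj y" "ccnj (- x) = - ccnj x"
  "ccnj (x - y) = ccnj x - ccnj y" "ccnj (x \<star> y) = ccnj y \<star> ccnj x" "ccnj (r *\<^sub>R x) = r *\<^sub>R ccnj x"
  by (auto simp: ccnj_def cmul_def qcnj_simps zero_prod_def split: prod.splits)

lemma ccnj_sum: "ccnj (sum f A) = (\<Sum>i\<in>A. ccnj (f i))"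
  by (induction A rule: infinite_finite_induct) (auto simp: ccnj_simps)


section \<open>The exceptional Jordan algebra\<close>

definition cmatmul :: "cayley^'n^'m \<Rightarrow> cayley^'k^'n \<Rightarrow> cayley^'k^'m" (infixl \<open>\<star>\<star>\<close> 70) where
  "A \<star>\<star> B = (\<chi> i j. \<Sum>k\<in>UNIV. A$i$k \<star> B$k$j)"

definition cadj :: "cayley^'n^'m \<Rightarrow> cayley^'m^'n" where
  "cadj A = (\<chi> i j. ccnj (A$j$i))"

lemma cadj_simps:
  "cadj 0 = 0" "cadj (A + B) = cadj A + cadj B" "cadj (- A) = - cadj A"
  "cadj (A - B) = cadj A - cadj B" "cadj (r *\<^sub>R A) = r *\<^sub>R cadj A" "cadj (A \<star>\<star> B) = cadj B \<star>\<star> cadj A"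
  by (auto simp: cadj_def cmatmul_def vec_eq_iff ccnj_simps ccnj_sum)

typedef jordan = "{X :: cayley^3^3. cadj X = X}"
  by (rule exI[of _ 0]) (simp add: cadj_simps)

setup_lifting type_definition_jordan

instantiation jordan :: real_vector
begin

lift_definition zero_jordan :: jordan is 0
  by (simp add: cadj_simps)

lift_definition plus_jordan :: "jordan \<Rightarrow> jordan \<Rightarrow> jordan" is "(+)"
  by (simp add: cadj_simps)

lift_definition uminus_jordan :: "jordan \<Rightarrow> jordan" is uminus
  by (simp add: cadj_simps)

lift_definition minus_jordan :: "jordan \<Rightarrow> jordan \<Rightarrow> jordan" is "(-)"
  by (simp add: cadj_simps)

lift_definition scaleR_jordan :: "real \<Rightarrow> jordan \<Rightarrow> jordan" is scaleR
  by (simp add: cadj_simps)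

instance
  by standard (transfer; simp add: algebra_simps)+

end

instantiation jordan :: real_normed_vector
begin

lift_definition norm_jordan :: "jordan \<Rightarrow> real" is norm .

definition "sgn X = X /\<^sub>R norm X" for X :: jordan

definition "dist X Y = norm (X - Y)" for X Y :: jordan

definition
  "(uniformity :: (jordan \<times> jordan) filter) = (INF e\<in>{0<..}. principal {(X, Y). dist X Y < e})"

definition
  "open (U :: jordan set) \<longleftrightarrow> (\<forall>X\<in>U. eventually (\<lambda>(X', Y). X' = X \<longrightarrow> Y \<in> U) uniformity)"

instance
proof
  fix X Y :: jordan and r :: real
  show "norm X = 0 \<longleftrightarrow> X = 0" "norm (X + Y) \<le> norm X + norm Y" "norm (r *\<^sub>R X) = \<bar>r\<bar> * norm X"
    by (transfer; simp add: norm_triangle_ineq)+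
qed (simp_all add: sgn_jordan_def dist_jordan_def
      uniformity_jordan_def open_jordan_def)

end

lift_definition junit :: jordan is "\<chi> i j. if i = j then (1, 0) else 0"
  by (auto simp: cadj_def vec_eq_iff ccnj_def qcnj_def one_quat_def zero_prod_def zero_quat_def
      uminus_quat_def)

lift_definition jprod :: "jordan \<Rightarrow> jordan \<Rightarrow> jordan" is
  "\<lambda>X Y. (1/2) *\<^sub>R (X \<star>\<star> Y + Y \<star>\<star> X)"
  by (simp add: cadj_simps add.commute)

lift_definition jtrace :: "jordan \<Rightarrow> real" is "\<lambda>X. \<Sum>i\<in>UNIV. cRe (X$i$i)" .

lift_definition jgamma :: "jordan \<Rightarrow> jordan" is
  "\<lambda>X. \<chi> i j. (fst (X$i$j), - snd (X$i$j))"
  by (auto simp: cadj_def vec_eq_iff ccnj_def prod_eq_iff)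

text \<open>The entries \<open>x\<^sub>2\<close> and \<open>x\<^sub>3\<close> occupy the off-diagonal places of the first row and column.\<close>

lift_definition jsigma :: "jordan \<Rightarrow> jordan" is
  "\<lambda>X. \<chi> i j. if (i = 1) = (j = 1) then X$i$j else - X$i$j"
  by (auto simp: cadj_def vec_eq_iff ccnj_simps)


section \<open>The complexified Jordan algebra\<close>

text \<open>The pair \<open>(X, Y)\<close> stands for \<open>X + iY\<close>.\<close>

type_synonym jordanC = "jordan \<times> jordan"

definition cscale :: "complex \<Rightarrow> jordanC \<Rightarrow> jordanC" (infixr \<open>*\<^sub>C\<close> 75) where
  "c *\<^sub>C X = (Re c *\<^sub>R fst X - Im c *\<^sub>R snd X, Re c *\<^sub>R snd X + Im c *\<^sub>R fst X)"

lemma vector_space_cscale: "vector_space cscale"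
  by unfold_locales (auto simp: cscale_def prod_eq_iff algebra_simps)

definition Eunit :: jordanC where
  "Eunit = (junit, 0)"

definition jcprod :: "jordanC \<Rightarrow> jordanC \<Rightarrow> jordanC" where
  "jcprod X Y = (jprod (fst X) (fst Y) - jprod (snd X) (snd Y),
                 jprod (fst X) (snd Y) + jprod (snd X) (fst Y))"

definition jctrace :: "jordanC \<Rightarrow> complex" where
  "jctrace X = Complex (jtrace (fst X)) (jtrace (snd X))"

definition jcform :: "jordanC \<Rightarrow> jordanC \<Rightarrow> complex" where
  "jcform X Y = jctrace (jcprod X Y)"

definition freudenthal :: "jordanC \<Rightarrow> jordanC \<Rightarrow> jordanC" where
  "freudenthal X Y = (1/2) *\<^sub>C (2 *\<^sub>C jcprod X Y - jctrace X *\<^sub>C Y - jctrace Y *\<^sub>C X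
     + (jctrace X * jctrace Y - jcform X Y) *\<^sub>C Eunit)"

definition jcdet :: "jordanC \<Rightarrow> complex" where
  "jcdet X = (1/3) * jcform X (freudenthal X X)"

definition \<tau> :: "jordanC \<Rightarrow> jordanC" where
  "\<tau> X = (fst X, - snd X)"

definition jcherm :: "jordanC \<Rightarrow> jordanC \<Rightarrow> complex" where
  "jcherm X Y = jcform (\<tau> X) Y"

definition \<gamma> :: "jordanC \<Rightarrow> jordanC" where
  "\<gamma> X = (jgamma (fst X), jgamma (snd X))"

definition \<sigma> :: "jordanC \<Rightarrow> jordanC" where
  "\<sigma> X = (jsigma (fst X), jsigma (snd X))"


section \<open>The group E6 and its subgroups\<close>

definition E6 :: "(jordanC \<Rightarrow> jordanC) set" where
  "E6 = {\<alpha>. Vector_Spaces.linear cscale cscale \<alpha> \<and> bij \<alpha> \<and>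
             (\<forall>X. jcdet (\<alpha> X) = jcdet X) \<and>
             (\<forall>X Y. jcherm (\<alpha> X) (\<alpha> Y) = jcherm X Y)}"

definition lam :: "(jordanC \<Rightarrow> jordanC) \<Rightarrow> (jordanC \<Rightarrow> jordanC)" where
  "lam \<alpha> = \<tau> \<circ> \<alpha> \<circ> \<tau>"

text \<open>On \<open>E6\<close>, \<open>lam \<alpha>\<close> is also the inverse transpose of \<open>\<alpha>\<close> with respect to \<open>jcform\<close>:\<close>

lemma jcform_lam:
  assumes "\<alpha> \<in> E6"
  shows "jcform (lam \<alpha> X) (\<alpha> Y) = jcform X Y"
proof -
  have "\<tau> (\<tau> X) = X" by (simp add: \<tau>_def)
  moreover have "jcherm (\<alpha> (\<tau> X)) (\<alpha> Y) = jcherm (\<tau> X) Y" using assms unfolding E6_def by blast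
  ultimately show ?thesis by (simp add: lam_def jcherm_def)
qed

definition E6_lam_gamma :: "(jordanC \<Rightarrow> jordanC) set" where
  "E6_lam_gamma = {\<alpha> \<in> E6. lam (\<gamma> \<circ> \<alpha> \<circ> \<gamma>) = \<alpha>}"

definition E6_lam_gamma_sigma :: "(jordanC \<Rightarrow> jordanC) set" where
  "E6_lam_gamma_sigma = {\<alpha> \<in> E6. lam (\<gamma> \<circ> \<sigma> \<circ> \<alpha> \<circ> \<sigma> \<circ> \<gamma>) = \<alpha>}"

definition comp_group :: "('a \<Rightarrow> 'a) set \<Rightarrow> ('a \<Rightarrow> 'a) monoid" where
  "comp_group S = \<lparr>carrier = S, mult = (\<circ>), one = id\<rparr>"


section \<open>The semidirect product\<close>

definition semidirect_prod ::
    "('a, 'c) monoid_scheme \<Rightarrow> ('b, 'd) monoid_scheme \<Rightarrow> ('b \<Rightarrow> 'a \<Rightarrow> 'a) \<Rightarrow> ('a \<times> 'b) monoid" where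
  "semidirect_prod N H \<theta> =
     \<lparr>carrier = carrier N \<times> carrier H,
      mult = (\<lambda>(n, h) (n', h'). (n \<otimes>\<^bsub>N\<^esub> \<theta> h n', h \<otimes>\<^bsub>H\<^esub> h')),
      one = (\<one>\<^bsub>N\<^esub>, \<one>\<^bsub>H\<^esub>)\<rparr>"

type_synonym sp2pair = "(quat^2^2) \<times> (quat^2^2)"

definition Sp2xSp2 :: "sp2pair monoid" where
  "Sp2xSp2 = Sp \<times>\<times> Sp"

definition Z2 :: "sp2pair set" where
  "Z2 = {(mat 1, mat 1), (- mat 1, - mat 1)}"

definition rho :: "sp2pair \<Rightarrow> sp2pair" where
  "rho = (\<lambda>(A, B). (B, A))"

text \<open>Elements of the quotient are cosets, so the induced action is \<open>g \<cdot> S = g ` S\<close>.\<close>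

definition target_group :: "(sp2pair set \<times> (sp2pair \<Rightarrow> sp2pair)) monoid" where
  "target_group = semidirect_prod (Sp2xSp2 Mod Z2) (comp_group {id, rho}) (\<lambda>g S. g ` S)"


section \<open>Topologies\<close>

text \<open>Sets of linear maps carry the subspace topology of the function space, that is, the topology
  of pointwise convergence; on a finite-dimensional space this is the usual topology of matrix
  groups. A homeomorphic isomorphism of closed matrix groups is an isomorphism of Lie groups.\<close>

definition quotient_topology :: "'a topology \<Rightarrow> ('a \<Rightarrow> 'b) \<Rightarrow> 'b topology" where
  "quotient_topology T q =
     topology (\<lambda>U. U \<subseteq> q ` topspace T \<and> openin T {x \<in> topspace T. q x \<in> U})"

lemma openin_quotient_topology:
  "openin (quotient_topology T q) U \<longleftrightarrow>
     U \<subseteq> q ` topspace T \<and> openin T {x \<in> topspace T. q x \<in> U}"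
proof -
  have "istopology (\<lambda>U. U \<subseteq> q ` topspace T \<and> openin T {x \<in> topspace T. q x \<in> U})"
    unfolding istopology_def
  proof (intro conjI allI impI)
    fix U V
    assume U: "U \<subseteq> q ` topspace T \<and> openin T {x \<in> topspace T. q x \<in> U}"
      and V: "V \<subseteq> q ` topspace T \<and> openin T {x \<in> topspace T. q x \<in> V}"
    have "{x \<in> topspace T. q x \<in> U \<inter> V} = {x \<in> topspace T. q x \<in> U} \<inter> {x \<in> topspace T. q x \<in> V}"
      by auto
    then show "openin T {x \<in> topspace T. q x \<in> U \<inter> V}" using U V by auto
    show "U \<inter> V \<subseteq> q ` topspace T" using U by auto
  next
    fix K
    assume K: "\<forall>S\<in>K. S \<subseteq> q ` topspace T \<and> openin T {x \<in> topspace T. q x \<in> S}"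
    have "{x \<in> topspace T. q x \<in> \<Union>K} = (\<Union>S\<in>K. {x \<in> topspace T. q x \<in> S})" by auto
    then show "openin T {x \<in> topspace T. q x \<in> \<Union>K}" using K by auto
    show "\<Union>K \<subseteq> q ` topspace T" using K by auto
  qed
  then show ?thesis by (simp add: quotient_topology_def topology_inverse')
qed

definition target_topology :: "(sp2pair set \<times> (sp2pair \<Rightarrow> sp2pair)) topology" where
  "target_topology =
     prod_topology
       (quotient_topology (top_of_set (carrier Sp2xSp2)) (\<lambda>x. Z2 #>\<^bsub>Sp2xSp2\<^esub> x))
       (discrete_topology {id, rho})"

end

(* The elements of both subgroups are the C-linear extensions of the orthogonal maps of the
   27-dimensional real form V = {X. tau gamma X = X} that preserve the determinant and commute with
   sigma. Identify V with R + R^5 + R^5 + M(2,H), where R^5 is realized as the traceless Hermitian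
   quaternionic matrices h(p) = [[s, u], [cnj u, -s]]. There sigma is v -> -v, and
     det(t,p,r,v) = t (|p|^2 - |r|^2) + <h(p) v, v> + <v h(r), v>,
     <X,X> = t^2 + 2|p|^2 + 2|r|^2 + 2|v|^2.
   Clearly Sp(2) x Sp(2) acts by v -> A v B*, h(p) -> A h(p) A*, h(r) -> B h(r) B*, and
   (t,p,r,v) -> (-t,r,p,v* ) exchanges the two factors. Conversely, an admissible map fixes the
   t-axis up to sign, because that axis is singled out by det; if the sign is +, it preserves
   |p| and |r| separately, and polarization shows that its odd part g satisfies
   g(h(p) v) = h(b1 p) g(v) and g(v h(r)) = g(v) h(b2 r). Since Sp(2) is transitive on orthonormal
   2-frames of R^5, g may be assumed to commute with the matrix units; then it acts entrywise by an
   isometry of H that is semilinear on both sides, hence of the form x -> p x q* by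
   Skolem-Noether. The topological statement follows since a continuous bijection from a compact
   space to a Hausdorff space is a homeomorphism. *)

theory Submission
  imports Defs
begin

section \<open>Quaternions as a Euclidean space\<close>

lemma quat_sel_simps [simp]:
  "q0 (x + y) = q0 x + q0 y" "q1 (x + y) = q1 x + q1 y"
  "q2 (x + y) = q2 x + q2 y" "q3 (x + y) = q3 x + q3 y"
  "q0 (x - y) = q0 x - q0 y" "q1 (x - y) = q1 x - q1 y"
  "q2 (x - y) = q2 x - q2 y" "q3 (x - y) = q3 x - q3 y"
  "q0 (- x) = - q0 x" "q1 (- x) = - q1 x" "q2 (- x) = - q2 x" "q3 (- x) = - q3 x"
  "q0 (c *\<^sub>R x) = c * q0 x" "q1 (c *\<^sub>R x) = c * q1 x"
  "q2 (c *\<^sub>R x) = c * q2 x" "q3 (c *\<^sub>R x) = c * q3 x"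
  "q0 0 = 0" "q1 0 = 0" "q2 0 = 0" "q3 0 = 0"
  "q0 1 = 1" "q1 1 = 0" "q2 1 = 0" "q3 1 = 0"
  "q0 (qcnj x) = q0 x" "q1 (qcnj x) = - q1 x" "q2 (qcnj x) = - q2 x" "q3 (qcnj x) = - q3 x"
  by (simp_all add: quat_ring_defs scaleR_quat_def qcnj_def)

lemma quat_sel_times:
  "q0 (x * y) = q0 x * q0 y - q1 x * q1 y - q2 x * q2 y - q3 x * q3 y"
  "q1 (x * y) = q0 x * q1 y + q1 x * q0 y + q2 x * q3 y - q3 x * q2 y"
  "q2 (x * y) = q0 x * q2 y - q1 x * q3 y + q2 x * q0 y + q3 x * q1 y"
  "q3 (x * y) = q0 x * q3 y + q1 x * q2 y - q2 x * q1 y + q3 x * q0 y"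
  by (simp_all add: times_quat_def)

lemma quat_eq_iff: "x = y \<longleftrightarrow> q0 x = q0 y \<and> q1 x = q1 y \<and> q2 x = q2 y \<and> q3 x = q3 y"
  by (auto intro: quat_eqI)

instantiation quat :: real_inner
begin

definition inner_quat :: "quat \<Rightarrow> quat \<Rightarrow> real" where
  "inner x y = q0 x * q0 y + q1 x * q1 y + q2 x * q2 y + q3 x * q3 y"

instance
proof
  fix x y z :: quat and r :: real
  show "inner x y = inner y x" "inner (x + y) z = inner x z + inner y z"
    "inner (r *\<^sub>R x) y = r * inner x y"
    by (simp_all add: inner_quat_def algebra_simps)
  show "0 \<le> inner x x" by (simp add: inner_quat_def)
  have "a * a + b * b + c * c + d * d = 0 \<longleftrightarrow> a = 0 \<and> b = 0 \<and> c = 0 \<and> d = 0" for a b c d :: real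
    by (simp add: add_nonneg_eq_0_iff)
  then show "inner x x = 0 \<longleftrightarrow> x = 0" by (simp add: inner_quat_def quat_eq_iff)
  show "norm x = sqrt (inner x x)"
    by (simp add: inner_quat_def norm_quat_def norm_prod_def power2_eq_square add.assoc)
qed

end

text \<open>The class axioms of a Euclidean space. Finite dimension is what later makes linear
  injections surjective and closed bounded sets compact.\<close>

lemma quat_orthonormal_basis:
  defines "B \<equiv> {Quat 1 0 0 0, Quat 0 1 0 0, Quat 0 0 1 0, Quat 0 0 0 1}"
  shows "B \<noteq> {}" "finite B" "u \<in> B \<Longrightarrow> v \<in> B \<Longrightarrow> inner u v = (if u = v then 1 else 0)"
    "(\<forall>u\<in>B. inner x u = 0) \<longleftrightarrow> x = 0"
  unfolding B_def
  subgoal by simp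
  subgoal by simp
  subgoal by (elim insertE emptyE; simp add: inner_quat_def)
  subgoal by (simp add: inner_quat_def quat_eq_iff [of x 0])
  done

instantiation quat :: euclidean_space
begin

definition Basis_quat :: "quat set" where
  "Basis = {Quat 1 0 0 0, Quat 0 1 0 0, Quat 0 0 1 0, Quat 0 0 0 1}"

instance
  by standard (fact quat_orthonormal_basis [folded Basis_quat_def])+

end

lemma norm_quat_sq: "(norm x)\<^sup>2 = (q0 x)\<^sup>2 + (q1 x)\<^sup>2 + (q2 x)\<^sup>2 + (q3 x)\<^sup>2" for x :: quat
  by (simp only: power2_norm_eq_inner) (simp add: inner_quat_def power2_eq_square)

instance quat :: real_algebra_1
proof
  fix x y :: quat and a :: real
  show "a *\<^sub>R x * y = a *\<^sub>R (x * y)" "x * a *\<^sub>R y = a *\<^sub>R (x * y)"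
    by (simp_all add: quat_eq_iff quat_sel_times algebra_simps)
qed

lemma qcnj_mult_self: "x * qcnj x = ((norm x)\<^sup>2) *\<^sub>R 1" "qcnj x * x = ((norm x)\<^sup>2) *\<^sub>R 1"
  by (simp_all add: quat_eq_iff quat_sel_times norm_quat_sq) (simp_all add: power2_eq_square)

text \<open>The factor \<open>y * qcnj y\<close> is a real scalar, hence central, and can be pulled
  out of the middle of \<open>x * (y * qcnj y) * qcnj x\<close>.\<close>

lemma norm_quat_mult: "norm (x * y) = norm x * norm y" for x y :: quat
proof (rule power2_eq_imp_eq)
  have "((norm (x * y))\<^sup>2) *\<^sub>R (1 :: quat) = x * (y * qcnj y) * qcnj x"
    by (simp add: qcnj_mult_self(1) [symmetric] qcnj_simps mult.assoc)
  also have "\<dots> = ((norm x * norm y)\<^sup>2) *\<^sub>R 1"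
    by (simp add: qcnj_mult_self power_mult_distrib)
  finally show "(norm (x * y))\<^sup>2 = (norm x * norm y)\<^sup>2" by (simp add: quat_eq_iff)
qed auto

instance quat :: real_normed_algebra_1
proof
  fix x y :: quat
  show "norm (x * y) \<le> norm x * norm y" by (simp add: norm_quat_mult)
  show "norm (1 :: quat) = 1" by (simp add: norm_eq_sqrt_inner inner_quat_def)
qed

lemma qcnj_1 [simp]: "qcnj 1 = 1"
  by (simp add: quat_eq_iff)

lemma norm_qcnj [simp]: "norm (qcnj x) = norm x"
  by (rule power2_eq_imp_eq) (simp_all add: norm_quat_sq)

lemma qcnj_unit: "norm x = 1 \<Longrightarrow> x * qcnj x = 1" "norm x = 1 \<Longrightarrow> qcnj x * x = 1"
  by (simp_all add: qcnj_mult_self)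

lemma linear_qcnj: "linear qcnj"
  by (rule linearI) (simp_all add: qcnj_simps)

lemma continuous_on_qcnj [continuous_intros]:
  "continuous_on S f \<Longrightarrow> continuous_on S (\<lambda>x. qcnj (f x))"
  by (rule bounded_linear.continuous_on [OF linear_qcnj [unfolded linear_conv_bounded_linear]])

section \<open>Center, automorphisms and bimodule isometries of the quaternions\<close>

lemma quat_central:
  assumes "\<And>x :: quat. a * x = x * a"
  shows "a = q0 a *\<^sub>R 1"
proof -
  \<comment> \<open>Commuting with i kills the components along j and k, commuting with j kills the
    one along i.\<close>
  have "a * Quat 0 1 0 0 = Quat 0 1 0 0 * a" "a * Quat 0 0 1 0 = Quat 0 0 1 0 * a" using assms by auto
  then show ?thesis by (auto simp: quat_eq_iff quat_sel_times)
qed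

lemma quat_decomp:
  "x = q0 x *\<^sub>R 1 + q1 x *\<^sub>R Quat 0 1 0 0 + q2 x *\<^sub>R Quat 0 0 1 0 + q3 x *\<^sub>R Quat 0 0 0 1"
  by (simp add: quat_eq_iff)

text \<open>Skolem--Noether: averaging over the units turns any \<open>w\<close> into an intertwiner \<open>P w\<close>, and
  the sum of \<open>P w * qcnj w\<close> over \<open>w = 1, I, J, K\<close> is \<open>4\<close>, so that one of the four is nonzero.\<close>

lemma quat_automorphism_inner:
  fixes k :: "quat \<Rightarrow> quat"
  assumes lin: "linear k" and mult: "\<And>x y. k (x * y) = k x * k y" and one: "k 1 = 1"
  shows "\<exists>p. norm p = 1 \<and> (\<forall>x. k x = p * x * qcnj p)"
proof -
  define I J K :: quat where "I = Quat 0 1 0 0" and "J = Quat 0 0 1 0" and "K = Quat 0 0 0 1"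
  define P where "P w = w - k I * w * I - k J * w * J - k K * w * K" for w
  have IJK: "I * I = -1" "J * J = -1" "K * K = -1" "I * J = K" "J * I = -K" "J * K = I" "K * J = -I"
    "K * I = J" "I * K = -J"
    by (simp_all add: I_def J_def K_def quat_eq_iff quat_sel_times)
  have neg: "k (- x) = - k x" for x using lin by (simp add: linear_neg)
  have kk: "k I * k I = -1" "k J * k J = -1" "k K * k K = -1" "k I * k J = k K" "k J * k I = - k K"
     "k J * k K = k I" "k K * k J = - k I" "k K * k I = k J" "k I * k K = - k J"
    by (simp_all add: mult [symmetric] IJK neg one)
  have kl: "k I * (k I * x) = -x" "k J * (k J * x) = -x" "k K * (k K * x) = -x"
     "k I * (k J * x) = k K * x" "k J * (k I * x) = - (k K * x)"
     "k J * (k K * x) = k I * x" "k K * (k J * x) = - (k I * x)"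
     "k K * (k I * x) = k J * x" "k I * (k K * x) = - (k J * x)" for x
    by (simp_all add: mult.assoc [symmetric] kk)
  have com: "k I * P w = P w * I" "k J * P w = P w * J" "k K * P w = P w * K" for w
    by (simp_all add: P_def algebra_simps kl IJK kk)
  have "P 1 - P I * I - P J * J - P K * K = 4"
    by (simp add: P_def algebra_simps IJK)
  then have "\<exists>w. P w \<noteq> 0" by (metis diff_0_right mult_zero_left zero_neq_numeral)
  then obtain w where "P w \<noteq> 0" by blast
  define p where "p = (1 / norm (P w)) *\<^sub>R P w"
  have p1: "norm p = 1" using \<open>P w \<noteq> 0\<close> by (simp add: p_def)
  have "k x * p = p * x" for x
  proof -
    have 1: "k I * p = p * I" "k J * p = p * J" "k K * p = p * K" by (simp_all add: p_def com)
    have x: "x = q0 x *\<^sub>R 1 + q1 x *\<^sub>R I + q2 x *\<^sub>R J + q3 x *\<^sub>R K"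
      unfolding I_def J_def K_def by (rule quat_decomp)
    have "k x = q0 x *\<^sub>R 1 + q1 x *\<^sub>R k I + q2 x *\<^sub>R k J + q3 x *\<^sub>R k K"
      by (subst x) (simp add: linear_add [OF lin] linear_scale [OF lin] one)
    then have "k x * p = q0 x *\<^sub>R p + q1 x *\<^sub>R (p * I) + q2 x *\<^sub>R (p * J) + q3 x *\<^sub>R (p * K)"
      by (simp add: distrib_right 1)
    also have "\<dots> = p * (q0 x *\<^sub>R 1 + q1 x *\<^sub>R I + q2 x *\<^sub>R J + q3 x *\<^sub>R K)"
      by (simp add: distrib_left)
    finally show ?thesis using x by simp
  qed
  then have "k x = p * x * qcnj p" for x
    by (metis mult.assoc mult.right_neutral p1 qcnj_unit(1))
  with p1 show ?thesis by blast
qed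

text \<open>Normalizing by \<open>u = h 1\<close> makes \<open>\<lambda>x. h x * qcnj u\<close>
  multiplicative, because left semilinearity gives \<open>\<phi> a = h a * qcnj u\<close>. By
  Skolem-Noether it is inner, and multiplying back by \<open>u\<close> separates the two units
  \<open>p\<close> and \<open>q = qcnj u * p\<close>.\<close>

lemma quat_bimodule_isometry:
  fixes h :: "quat \<Rightarrow> quat"
  assumes lin: "linear h" and norm: "\<And>x. norm (h x) = norm x"
    and left: "\<And>a x. h (a * x) = \<phi> a * h x" and right: "\<And>x b. h (x * b) = h x * \<psi> b"
  obtains p q where "norm p = 1" "norm q = 1" "\<And>x. h x = p * x * qcnj q"
proof -
  define u where "u = h 1"
  have u: "norm u = 1" by (simp add: u_def norm)
  have hphi: "h a = \<phi> a * u" for a using left[of a 1] by (simp add: u_def)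
  have phi: "\<phi> a = h a * qcnj u" for a using hphi[of a] u by (simp add: mult.assoc qcnj_unit)
  have "linear (\<lambda>x. h x * qcnj u)"
    by (rule linearI) (simp_all add: linear_add [OF lin] linear_scale [OF lin] distrib_right)
  moreover have "h (x * y) * qcnj u = h x * qcnj u * (h y * qcnj u)" for x y
    by (simp add: left phi mult.assoc)
  moreover have "h 1 * qcnj u = 1" using u by (simp add: u_def [symmetric] qcnj_unit)
  ultimately obtain p where p: "norm p = 1" "\<And>x. h x * qcnj u = p * x * qcnj p"
    using quat_automorphism_inner [of "\<lambda>x. h x * qcnj u"] by auto
  show thesis
  proof
    show "norm p = 1" by fact
    show "norm (qcnj u * p) = 1" using u p by (simp add: norm_quat_mult)
    show "h x = p * x * qcnj (qcnj u * p)" for x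
    proof -
      have "h x = h x * qcnj u * u" using u by (simp add: mult.assoc qcnj_unit)
      then show ?thesis using p(2)[of x] by (simp add: qcnj_simps mult.assoc)
    qed
  qed
qed

section \<open>Quaternionic 2 by 2 matrices\<close>

lemma qcnj_0 [simp]: "qcnj 0 = 0"
  by (simp add: qcnj_simps)

definition adj :: "quat^'n^'m \<Rightarrow> quat^'m^'n" where
  "adj A = (\<chi> i j. qcnj (A$j$i))"

definition m2 :: "quat \<Rightarrow> quat \<Rightarrow> quat \<Rightarrow> quat \<Rightarrow> quat^2^2" where
  "m2 a b c d = vector [vector [a, b], vector [c, d]]"

lemma m2_nth [simp]:
  "m2 a b c d $ 1 $ 1 = a" "m2 a b c d $ 1 $ 2 = b" "m2 a b c d $ 2 $ 1 = c" "m2 a b c d $ 2 $ 2 = d"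
  by (simp_all add: m2_def)

lemma mat2_eq_iff:
  "(A :: 'a^2^2) = B \<longleftrightarrow>
     A$1$1 = B$1$1 \<and> A$1$2 = B$1$2 \<and> A$2$1 = B$2$1 \<and> A$2$2 = B$2$2"
  by (auto simp: vec_eq_iff forall_2)

lemma m2_eta: "A = m2 (A$1$1) (A$1$2) (A$2$1) (A$2$2)"
  by (simp add: mat2_eq_iff)

lemma m2_cases: obtains a b c d where "A = m2 a b c d"
  using m2_eta by blast

lemma m2_simps:
  "m2 a b c d ** m2 a' b' c' d' =
     m2 (a * a' + b * c') (a * b' + b * d') (c * a' + d * c') (c * b' + d * d')"
  "m2 a b c d + m2 a' b' c' d' = m2 (a + a') (b + b') (c + c') (d + d')"
  "m2 a b c d - m2 a' b' c' d' = m2 (a - a') (b - b') (c - c') (d - d')"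
  "- m2 a b c d = m2 (- a) (- b) (- c) (- d)"
  "r *\<^sub>R m2 a b c d = m2 (r *\<^sub>R a) (r *\<^sub>R b) (r *\<^sub>R c) (r *\<^sub>R d)"
  "adj (m2 a b c d) = m2 (qcnj a) (qcnj c) (qcnj b) (qcnj d)"
  by (simp_all add: mat2_eq_iff matrix_matrix_mult_def sum_2 adj_def)

lemma m2_eq_iff: "m2 a b c d = m2 a' b' c' d' \<longleftrightarrow> a = a' \<and> b = b' \<and> c = c' \<and> d = d'"
  by (simp add: mat2_eq_iff)

lemma mat_m2: "mat 1 = m2 1 0 0 1" "0 = m2 0 0 0 0"
  by (simp_all add: mat2_eq_iff mat_def)

lemma adj_simps:
  "adj (adj A) = A" "adj (A ** B) = adj B ** adj A" "adj (mat 1 :: quat^2^2) = mat 1" "adj (- A) = - adj A"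
  "adj (A + B) = adj A + adj B" "adj (r *\<^sub>R A) = r *\<^sub>R adj A" for A B :: "quat^2^2"
  by (simp_all only: mat2_eq_iff) (simp_all add: adj_def matrix_matrix_mult_def sum_2 qcnj_simps mat_def)

lemma quatmat_scale:
  "(r *\<^sub>R A) ** B = r *\<^sub>R (A ** B)" "A ** (r *\<^sub>R B) = r *\<^sub>R (A ** B)" for A B :: "quat^2^2"
  by (simp_all add: mat2_eq_iff matrix_matrix_mult_def sum_2 scaleR_add_right)

lemma quatmat_minus:
  "(- A) ** B = - (A ** B)" "A ** (- B) = - (A ** B)" for A B :: "quat^2^2"
  by (simp_all add: mat2_eq_iff matrix_matrix_mult_def sum_2)

lemma quatmat_distrib:
  "(A + B) ** C = A ** C + B ** C" "C ** (A + B) = C ** A + C ** B" for A B C :: "quat^2^2"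
  by (simp_all add: mat2_eq_iff matrix_matrix_mult_def sum_2 algebra_simps)

lemma quatmat_one [simp]: "mat 1 ** A = A" "A ** mat 1 = A" for A :: "quat^2^2"
  by simp_all

lemma linear_sandwich: "linear (\<lambda>v. A ** v ** B)" for A B :: "quat^2^2"
  by (rule linearI) (simp_all add: quatmat_distrib quatmat_scale)

lemma inner_quat_times:
  "inner (a * x) y = inner x (qcnj a * y)" for x y a :: quat
  by (simp add: inner_quat_def quat_sel_times algebra_simps)

lemma inner_quat_times_right:
  "inner (x * a) y = inner x (y * qcnj a)" for x y a :: quat
  by (simp add: inner_quat_def quat_sel_times algebra_simps)

lemma inner_m2: "inner A B = inner (A$1$1) (B$1$1) + inner (A$1$2) (B$1$2) + inner (A$2$1) (B$2$1)
    + inner (A$2$2) (B$2$2)" for A B :: "quat^2^2"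
  by (simp add: inner_vec_def sum_2)

lemma inner_quatmat_times: "inner (A ** v) w = inner v (adj A ** w)" for A v w :: "quat^2^2"
  by (simp add: inner_m2 matrix_matrix_mult_def sum_2 adj_def inner_quat_times
      inner_add_left inner_add_right)

lemma inner_quatmat_times_right: "inner (v ** A) w = inner v (w ** adj A)" for A v w :: "quat^2^2"
  by (simp add: inner_m2 matrix_matrix_mult_def sum_2 adj_def inner_quat_times_right
      inner_add_left inner_add_right)


section \<open>The symplectic group and traceless Hermitian matrices\<close>

lemma carrier_Sp: "A \<in> carrier Sp \<longleftrightarrow> A ** adj A = mat 1"
  by (simp add: Sp_def adj_def)

text \<open>Left multiplication by \<open>A\<close> is a surjective linear endomorphism of a
  finite-dimensional real space, hence injective, so \<open>A\<close> cancels in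
  \<open>A ** (adj A ** A) = A ** mat 1\<close>.\<close>

lemma Sp_left_inverse:
  fixes A :: "quat^2^2"
  assumes "A ** adj A = mat 1"
  shows "adj A ** A = mat 1"
proof -
  have lin: "linear (\<lambda>v :: quat^2^2. A ** v)" using linear_sandwich [of A "mat 1"] by simp
  moreover have "surj (\<lambda>v :: quat^2^2. A ** v)"
    by (rule surjI [of _ "\<lambda>v. adj A ** v"]) (simp add: matrix_mul_assoc assms)
  ultimately have "inj (\<lambda>v :: quat^2^2. A ** v)" by (rule linear_surj_imp_inj)
  moreover have "A ** (adj A ** A) = A ** mat 1" by (simp add: matrix_mul_assoc assms)
  ultimately show ?thesis by (rule injD)
qed

lemma Sp_simps:
  fixes A v :: "quat^2^2"
  assumes "A \<in> carrier Sp"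
  shows "A ** adj A = mat 1" "adj A ** A = mat 1" "A ** (adj A ** v) = v" "adj A ** (A ** v) = v"
    "v ** A ** adj A = v" "v ** adj A ** A = v"
proof -
  show 1: "A ** adj A = mat 1" using assms by (simp add: carrier_Sp)
  then show 2: "adj A ** A = mat 1" by (rule Sp_left_inverse)
  show "A ** (adj A ** v) = v" "adj A ** (A ** v) = v" by (simp_all add: matrix_mul_assoc 1 2)
  show "v ** A ** adj A = v" "v ** adj A ** A = v"
    by (simp_all add: matrix_mul_assoc [symmetric] 1 2)
qed

lemma Sp_mult: "A \<in> carrier Sp \<Longrightarrow> B \<in> carrier Sp \<Longrightarrow> A ** B \<in> carrier Sp" for A B :: "quat^2^2"
  by (simp add: carrier_Sp adj_simps matrix_mul_assoc Sp_simps)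

lemma Sp_adj: "A \<in> carrier Sp \<Longrightarrow> adj A \<in> carrier Sp" for A :: "quat^2^2"
  by (simp add: Sp_simps carrier_Sp adj_simps)

lemma Sp_one_uminus:
  "mat 1 \<in> carrier (Sp :: (quat^2^2) monoid)" "A \<in> carrier Sp \<Longrightarrow> - A \<in> carrier Sp" for A :: "quat^2^2"
  by (simp_all add: carrier_Sp adj_simps quatmat_minus)

lemma inner_sandwich:
  fixes A B v w :: "quat^2^2"
  assumes A: "A \<in> carrier Sp" and B: "B \<in> carrier Sp"
  shows "inner (A ** v ** adj B) (A ** w ** adj B) = inner v w"
proof -
  have "inner (A ** v ** adj B) (A ** w ** adj B) = inner (A ** v) (A ** w)"
    using B by (subst inner_quatmat_times_right) (simp add: adj_simps Sp_simps)
  also have "\<dots> = inner v w"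
    using A by (subst inner_quatmat_times) (simp add: Sp_simps)
  finally show ?thesis .
qed

section \<open>Traceless Hermitian matrices as a Clifford model of Euclidean R^5\<close>

definition hm :: "real \<times> quat \<Rightarrow> quat^2^2" where
  "hm p = m2 (fst p *\<^sub>R 1) (snd p) (qcnj (snd p)) (- fst p *\<^sub>R 1)"

text \<open>Recovers a matrix only if it is Hermitian with vanishing trace, since the other entries
  are then determined by these two.\<close>

definition unhm :: "quat^2^2 \<Rightarrow> real \<times> quat" where
  "unhm M = (q0 (M$1$1), M$1$2)"

lemma hm_simps:
  "hm (p + q) = hm p + hm q" "hm (r *\<^sub>R p) = r *\<^sub>R hm p" "hm (p - q) = hm p - hm q" "hm (- p) = - hm p"
  "adj (hm p) = hm p" "hm 0 = 0"
  by (simp_all add: hm_def m2_simps m2_eq_iff mat_m2 quat_eq_iff algebra_simps)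

lemma unhm_hm [simp]: "unhm (hm p) = p"
  by (simp add: hm_def unhm_def)

lemma hm_inject: "hm p = hm q \<longleftrightarrow> p = q"
  by (metis unhm_hm)

lemma linear_unhm: "linear unhm"
  by (rule linearI) (simp_all add: unhm_def)

lemma hm_unhm:
  assumes "adj M = M" "q0 (M$1$1) + q0 (M$2$2) = 0"
  shows "hm (unhm M) = M"
  using assms by (cases M rule: m2_cases) (simp add: hm_def unhm_def m2_simps m2_eq_iff, simp add: quat_eq_iff)

text \<open>The trace over a noncommutative ring is not cyclic, but its real part is. This is how
  conjugation by \<open>Sp\<close> keeps the matrices \<open>hm p\<close> traceless.\<close>

lemma q0_trace_commute:
  "q0 ((A ** B)$1$1) + q0 ((A ** B)$2$2) = q0 ((B ** A)$1$1) + q0 ((B ** A)$2$2)" for A B :: "quat^2^2"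
  by (simp add: matrix_matrix_mult_def sum_2 quat_sel_times algebra_simps)

lemma hm_conj:
  assumes "A \<in> carrier Sp"
  shows "hm (unhm (A ** hm p ** adj A)) = A ** hm p ** adj A"
proof (rule hm_unhm)
  show "adj (A ** hm p ** adj A) = A ** hm p ** adj A"
    by (simp add: adj_simps hm_simps matrix_mul_assoc)
  show "q0 ((A ** hm p ** adj A)$1$1) + q0 ((A ** hm p ** adj A)$2$2) = 0"
    using q0_trace_commute [of A "hm p ** adj A"] assms
    by (simp add: matrix_mul_assoc Sp_simps) (simp add: hm_def)
qed

text \<open>The Clifford relation of R^5. It makes \<open>hm\<close> of a unit vector an involution
  in \<open>Sp\<close>, and it forces the maps of R^5 induced by an intertwiner to be
  isometries.\<close>

lemma hm_anticommutator: "hm p ** hm q + hm q ** hm p = (2 * inner p q) *\<^sub>R mat 1"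
  by (cases p; cases q)
    (simp add: hm_def m2_simps m2_eq_iff mat_m2 quat_eq_iff quat_sel_times inner_quat_def algebra_simps)

lemma hm_square: "hm p ** hm p = ((norm p)\<^sup>2) *\<^sub>R mat 1"
proof -
  have "2 *\<^sub>R (hm p ** hm p) = 2 *\<^sub>R ((norm p)\<^sup>2 *\<^sub>R mat 1)"
    using hm_anticommutator [of p p] by (simp add: power2_norm_eq_inner scaleR_2)
  then show ?thesis by (simp only: scaleR_cancel_left) simp
qed

lemma inner_hm: "inner (hm p) (hm q) = 2 * inner p q"
  by (cases p; cases q) (simp add: hm_def inner_m2 inner_quat_def algebra_simps)

lemma norm_unhm_conj:
  assumes "A \<in> carrier Sp"
  shows "norm (unhm (A ** hm p ** adj A)) = norm p"
proof -
  have "2 * inner (unhm (A ** hm p ** adj A)) (unhm (A ** hm p ** adj A)) = 2 * inner p p"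
    using assms by (simp only: inner_hm [symmetric] hm_conj inner_sandwich)
  then show ?thesis by (simp add: norm_eq_sqrt_inner)
qed

section \<open>Transitivity of Sp(2) on frames, and isometries compatible with Clifford
  multiplication\<close>

text \<open>For \<open>e = (1, 0)\<close> and \<open>p \<noteq> - e\<close>, conjugation with the unit vector in direction \<open>p + e\<close> is the
  rotation that swaps \<open>e\<close> and \<open>p\<close>.\<close>

lemma Sp2_transitive_sphere:
  assumes p: "norm p = 1"
  obtains U where "U \<in> carrier Sp" "U ** hm (1, 0) ** adj U = hm p"
proof (cases "p = (-1, 0)")
  case True
  \<comment> \<open>Here p + (1, 0) vanishes and defines no direction; the permutation matrix
    exchanges the diagonal entries of diag(1, -1) instead.\<close>
  have "m2 0 1 1 0 \<in> carrier Sp" by (simp add: carrier_Sp m2_simps mat_m2)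
  moreover have "m2 0 1 1 0 ** hm (1, 0) ** adj (m2 0 1 1 0) = hm p"
    by (simp add: m2_simps hm_def m2_eq_iff True)
  ultimately show thesis using that by blast
next
  case False
  define e :: "real \<times> quat" where "e = (1, 0)"
  have "p + e \<noteq> 0" using False by (cases p) (auto simp: e_def zero_prod_def)
  define c where "c = norm (p + e)"
  define U where "U = hm ((1 / c) *\<^sub>R (p + e))"
  have "c \<noteq> 0" using \<open>p + e \<noteq> 0\<close> by (simp add: c_def)
  have e: "norm e = 1" by (simp add: e_def norm_prod_def)
  have adj: "adj U = U" by (simp only: U_def hm_simps(5))
  have UU: "U ** U = mat 1"
    using \<open>c \<noteq> 0\<close> by (simp add: U_def hm_square c_def del: norm_minus_cancel)
  have "hm p ** hm p = mat 1" "hm e ** hm e = mat 1" using p e by (simp_all add: hm_square)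
  \<comment> \<open>Both sides equal \<open>mat 1 + hm p ** hm e\<close>, because
    \<open>hm p\<close> and \<open>hm e\<close> square to the identity.\<close>
  then have "hm (p + e) ** hm e = hm p ** hm (p + e)"
    by (simp add: hm_simps quatmat_distrib add.commute)
  then have "U ** hm e = hm p ** U"
    by (simp add: U_def hm_simps(2) quatmat_scale)
  then have "U ** hm e ** U = hm p" by (simp add: matrix_mul_assoc [symmetric] UU)
  moreover have "U \<in> carrier Sp" by (simp add: carrier_Sp adj UU)
  ultimately show thesis using that adj e_def by metis
qed

text \<open>Pulling \<open>q\<close> back by some \<open>U\<close> that moves (1, 0) to
  \<open>p\<close> gives a unit vector orthogonal to (1, 0), hence of the form (0, u). The matrix
  diag(u, 1) stabilizes (1, 0) and carries (0, 1) to (0, u).\<close>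

lemma Sp2_transitive_frames:
  assumes p: "norm p = 1" and q: "norm q = 1" and pq: "inner p q = 0"
  obtains A where "A \<in> carrier Sp" "A ** hm (1, 0) ** adj A = hm p" "A ** hm (0, 1) ** adj A = hm q"
proof -
  obtain U where U: "U \<in> carrier Sp" "U ** hm (1, 0) ** adj U = hm p"
    using Sp2_transitive_sphere p by blast
  define w where "w = unhm (adj U ** hm q ** U)"
  have w: "hm w = adj U ** hm q ** U" "norm w = 1"
    using hm_conj [OF Sp_adj [OF U(1)], of q] norm_unhm_conj [OF Sp_adj [OF U(1)], of q] q
    by (simp_all add: w_def adj_simps)
  have "2 * inner w (1, 0) = inner (hm w) (hm (1, 0))" by (simp add: inner_hm)
  also have "\<dots> = inner (hm q) (U ** hm (1, 0) ** adj U)"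
    unfolding w by (subst inner_quatmat_times_right, subst inner_quatmat_times)
      (simp add: adj_simps matrix_mul_assoc)
  also have "\<dots> = 0" using pq by (simp add: U(2) inner_hm inner_commute)
  finally have "fst w = 0" by (cases w) simp
  then obtain u where wu: "w = (0, u)" by (cases w) auto
  then have u: "norm u = 1" using w(2) by (simp add: norm_prod_def)
  define D where "D = m2 u 0 0 1"
  have D: "D \<in> carrier Sp" using u by (simp add: carrier_Sp D_def m2_simps mat_m2 qcnj_unit m2_eq_iff qcnj_simps)
  have D1: "D ** hm (1, 0) ** adj D = hm (1, 0)" and D2: "D ** hm (0, 1) ** adj D = hm w"
    using u by (simp_all add: D_def hm_def m2_simps m2_eq_iff qcnj_unit wu qcnj_simps)
  have conj: "U ** D ** x ** adj (U ** D) = U ** (D ** x ** adj D) ** adj U" for x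
    by (simp add: adj_simps matrix_mul_assoc)
  have "U ** hm w ** adj U = hm q"
    by (simp add: w matrix_mul_assoc Sp_simps [OF U(1)])
  then show thesis
    using that [OF Sp_mult [OF U(1) D]] D1 D2 U(2) by (simp only: conj)
qed

text \<open>A map commuting with the matrix units acts entrywise; what remains is a bimodule map of \<open>\<bbbH>\<close>.\<close>

lemma sandwich_of_normalized:
  fixes g :: "quat^2^2 \<Rightarrow> quat^2^2"
  assumes lin: "linear g" and norm: "\<And>v. norm (g v) = norm v"
    and left: "\<And>p v. g (hm p ** v) = hm (b1 p) ** g v"
    and right: "\<And>p v. g (v ** hm p) = g v ** hm (b2 p)"
    and b1: "b1 (1, 0) = (1, 0)" "b1 (0, 1) = (0, 1)"
    and b2: "b2 (1, 0) = (1, 0)" "b2 (0, 1) = (0, 1)"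
  shows "\<exists>A B. A \<in> carrier Sp \<and> B \<in> carrier Sp \<and> (\<forall>v. g v = A ** v ** adj B)"
proof -
  define h where "h x = g (m2 x 0 0 0) $ 1 $ 1" for x
  have D: "hm (1, 0) = m2 1 0 0 (-1)" and S: "hm (0, 1) = m2 0 1 1 0"
    by (simp_all add: hm_def m2_eq_iff)
  have g11: "g (m2 x 0 0 0) = m2 (h x) 0 0 0" for x
  proof -
    \<comment> \<open>Multiplication by diag(1, -1) from either side fixes
      \<open>m2 x 0 0 0\<close>, hence also its image; all entries of the image but the one in place
      (1, 1) then equal their negatives.\<close>
    have eq: "g (m2 x 0 0 0) = m2 1 0 0 (-1) ** g (m2 x 0 0 0)"
      "g (m2 x 0 0 0) = g (m2 x 0 0 0) ** m2 1 0 0 (-1)"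
      using left [of "(1, 0)" "m2 x 0 0 0"] right [of "m2 x 0 0 0" "(1, 0)"]
      by (simp_all add: b1 b2 D m2_simps)
    obtain a b c d where m: "g (m2 x 0 0 0) = m2 a b c d" by (rule m2_cases)
    have z: "y = - y \<Longrightarrow> y = 0" for y :: quat by (simp add: quat_eq_iff)
    have "h x = a" by (simp add: h_def m)
    moreover have "b = 0" "c = 0" "d = 0" using eq by (auto simp: m m2_simps m2_eq_iff intro: z)
    ultimately show ?thesis using m by simp
  qed
  have g12: "g (m2 0 x 0 0) = m2 0 (h x) 0 0" for x
    using right [of "m2 x 0 0 0" "(0, 1)"] by (simp add: b2 S m2_simps g11)
  have g21: "g (m2 0 0 x 0) = m2 0 0 (h x) 0" for x
    using left [of "(0, 1)" "m2 x 0 0 0"] by (simp add: b1 S m2_simps g11)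
  have g22: "g (m2 0 0 0 x) = m2 0 0 0 (h x)" for x
    using left [of "(0, 1)" "m2 0 x 0 0"] by (simp add: b1 S m2_simps g12)
  have g: "g (m2 a b c d) = m2 (h a) (h b) (h c) (h d)" for a b c d
  proof -
    have "m2 a b c d = m2 a 0 0 0 + m2 0 b 0 0 + m2 0 0 c 0 + m2 0 0 0 d" by (simp add: m2_simps)
    then show ?thesis by (simp add: linear_add [OF lin] g11 g12 g21 g22) (simp add: m2_simps)
  qed
  have linh: "linear h"
  proof (rule linearI)
    show "h (x + y) = h x + h y" for x y
      using linear_add [OF lin, of "m2 x 0 0 0" "m2 y 0 0 0"] by (simp add: m2_simps g11 m2_eq_iff)
    show "h (r *\<^sub>R x) = r *\<^sub>R h x" for r x
      using linear_scale [OF lin, of r "m2 x 0 0 0"] by (simp add: m2_simps g11 m2_eq_iff)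
  qed
  have nm: "norm (m2 x 0 0 0) = norm x" for x by (simp add: norm_eq_sqrt_inner inner_m2)
  have normh: "norm (h x) = norm x" for x using norm [of "m2 x 0 0 0"] by (simp add: g11 nm)
  \<comment> \<open>\<open>hm (0, a)\<close> moves the entry \<open>x\<close> in place (2, 1) to
    \<open>a * x\<close> in place (1, 1), which turns the intertwining law of \<open>g\<close> into
    semilinearity of \<open>h\<close>.\<close>
  have lefth: "h (a * x) = snd (b1 (0, a)) * h x" for a x
    using left [of "(0, a)" "m2 0 0 x 0"] by (simp add: hm_def m2_simps g m2_eq_iff linear_0 [OF linh])
  have righth: "h (x * a) = h x * snd (b2 (0, a))" for a x
    using right [of "m2 x 0 0 0" "(0, a)"] by (simp add: hm_def m2_simps g m2_eq_iff linear_0 [OF linh])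
  obtain p q where pq: "norm p = 1" "norm q = 1" "\<And>x. h x = p * x * qcnj q"
    using quat_bimodule_isometry [OF linh normh lefth righth] by blast
  have "m2 p 0 0 p \<in> carrier Sp" "m2 q 0 0 q \<in> carrier Sp"
    using pq by (simp_all add: carrier_Sp m2_simps mat_m2 qcnj_unit qcnj_simps)
  moreover have "g v = m2 p 0 0 p ** v ** adj (m2 q 0 0 q)" for v
    by (cases v rule: m2_cases) (simp add: g m2_simps pq qcnj_simps)
  ultimately show ?thesis by blast
qed

text \<open>The intertwining laws and the Clifford relation make \<open>b1\<close> and
  \<open>b2\<close> isometries of R^5. Hence elements of \<open>Sp\<close> can move the images of
  the frame (1, 0), (0, 1) back, and the corrected map \<open>g'\<close> is covered by
  \<open>sandwich_of_normalized\<close>.\<close>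

lemma clifford_isometry_sandwich:
  fixes g :: "quat^2^2 \<Rightarrow> quat^2^2"
  assumes lin: "linear g" and norm: "\<And>v. norm (g v) = norm v"
    and left: "\<And>p v. g (hm p ** v) = hm (b1 p) ** g v"
    and right: "\<And>p v. g (v ** hm p) = g v ** hm (b2 p)"
  obtains A B where "A \<in> carrier Sp" "B \<in> carrier Sp" "\<And>v. g v = A ** v ** adj B"
proof -
  define w where "w = g (mat 1)"
  have "norm w \<noteq> 0" by (simp add: w_def norm) (simp add: mat_m2 m2_eq_iff)
  then have w0: "w \<noteq> 0" by simp
  \<comment> \<open>Anticommutators are scalars, so \<open>g\<close> of an anticommutator compares
    two multiples of the nonzero matrix \<open>w\<close>.\<close>
  have "(2 * inner (b1 p) (b1 q)) *\<^sub>R w = (2 * inner p q) *\<^sub>R w" for p q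
  proof -
    have "(2 * inner (b1 p) (b1 q)) *\<^sub>R w = (hm (b1 p) ** hm (b1 q) + hm (b1 q) ** hm (b1 p)) ** w"
      by (simp add: hm_anticommutator quatmat_scale)
    also have "\<dots> = g ((hm p ** hm q + hm q ** hm p) ** mat 1)"
      by (simp only: quatmat_distrib matrix_mul_assoc [symmetric] left w_def linear_add [OF lin])
    also have "\<dots> = (2 * inner p q) *\<^sub>R w"
      by (simp add: hm_anticommutator linear_scale [OF lin] w_def)
    finally show ?thesis .
  qed
  then have ib1: "inner (b1 p) (b1 q) = inner p q" for p q using w0 by simp
  have "(2 * inner (b2 p) (b2 q)) *\<^sub>R w = (2 * inner p q) *\<^sub>R w" for p q
  proof -
    have "(2 * inner (b2 p) (b2 q)) *\<^sub>R w = w ** (hm (b2 p) ** hm (b2 q) + hm (b2 q) ** hm (b2 p))"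
      by (simp add: hm_anticommutator quatmat_scale)
    also have "\<dots> = g (mat 1 ** (hm p ** hm q + hm q ** hm p))"
      by (simp only: quatmat_distrib matrix_mul_assoc right w_def linear_add [OF lin])
    also have "\<dots> = (2 * inner p q) *\<^sub>R w"
      by (simp add: hm_anticommutator linear_scale [OF lin] w_def)
    finally show ?thesis .
  qed
  then have ib2: "inner (b2 p) (b2 q) = inner p q" for p q using w0 by simp
  have frame: "norm (b (1, 0)) = 1 \<and> norm (b (0, 1)) = 1 \<and> inner (b (1, 0)) (b (0, 1)) = 0"
    if "\<And>p q. inner (b p) (b q) = inner p q" for b :: "real \<times> quat \<Rightarrow> real \<times> quat"
    by (simp add: norm_eq_sqrt_inner that) (simp add: inner_quat_def)
  obtain A where A: "A \<in> carrier Sp" "A ** hm (1, 0) ** adj A = hm (b1 (1, 0))"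
      "A ** hm (0, 1) ** adj A = hm (b1 (0, 1))"
    using Sp2_transitive_frames frame [of b1, OF ib1] by metis
  obtain B where B: "B \<in> carrier Sp" "B ** hm (1, 0) ** adj B = hm (b2 (1, 0))"
      "B ** hm (0, 1) ** adj B = hm (b2 (0, 1))"
    using Sp2_transitive_frames frame [of b2, OF ib2] by metis
  define g' where "g' v = adj A ** g v ** B" for v
  define c1 where "c1 p = unhm (adj A ** hm (b1 p) ** A)" for p
  define c2 where "c2 p = unhm (adj B ** hm (b2 p) ** B)" for p
  have hc: "hm (c1 p) = adj A ** hm (b1 p) ** A" "hm (c2 p) = adj B ** hm (b2 p) ** B" for p
    using hm_conj [OF Sp_adj [OF A(1)], of "b1 p"] hm_conj [OF Sp_adj [OF B(1)], of "b2 p"]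
    by (simp_all add: c1_def c2_def adj_simps)
  have gg: "g v = A ** g' v ** adj B" for v
    by (simp add: g'_def matrix_mul_assoc [symmetric] Sp_simps [OF A(1)] Sp_simps [OF B(1)])
  have "\<exists>A' B'. A' \<in> carrier Sp \<and> B' \<in> carrier Sp \<and> (\<forall>v. g' v = A' ** v ** adj B')"
  proof (rule sandwich_of_normalized [of g' c1 c2])
    show "linear g'"
      unfolding g'_def using linear_compose [OF lin linear_sandwich [of "adj A" B]] by (simp add: o_def)
    show "norm (g' v) = norm v" for v
      using inner_sandwich [OF Sp_adj [OF A(1)] Sp_adj [OF B(1)], of "g v" "g v"] norm [of v]
      by (simp add: g'_def norm_eq_sqrt_inner adj_simps)
    show "g' (hm p ** v) = hm (c1 p) ** g' v" for p v
      by (simp add: g'_def hc left matrix_mul_assoc Sp_simps [OF A(1)])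
    show "g' (v ** hm p) = g' v ** hm (c2 p)" for p v
      by (simp add: g'_def hc right matrix_mul_assoc Sp_simps [OF B(1)])
    have "hm (c1 (1, 0)) = hm (1, 0)" "hm (c1 (0, 1)) = hm (0, 1)"
      "hm (c2 (1, 0)) = hm (1, 0)" "hm (c2 (0, 1)) = hm (0, 1)"
      by (simp_all add: hc A(2,3) [symmetric] B(2,3) [symmetric] matrix_mul_assoc
          Sp_simps [OF A(1)] Sp_simps [OF B(1)])
    then show "c1 (1, 0) = (1, 0)" "c1 (0, 1) = (0, 1)" "c2 (1, 0) = (1, 0)" "c2 (0, 1) = (0, 1)"
      by (simp_all only: hm_inject)
  qed
  then obtain A' B' where AB: "A' \<in> carrier Sp" "B' \<in> carrier Sp" "\<And>v. g' v = A' ** v ** adj B'"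
    by blast
  show thesis
  proof
    show "A ** A' \<in> carrier Sp" "B ** B' \<in> carrier Sp" using A B AB by (simp_all add: Sp_mult)
    show "g v = A ** A' ** v ** adj (B ** B')" for v
      by (simp add: gg AB adj_simps matrix_mul_assoc)
  qed
qed

text \<open>Taking \<open>v = mat 1\<close> gives \<open>A = B\<close>, so \<open>A\<close> commutes
  with every matrix. Matrix units make it scalar, \<open>quat_central\<close> makes the scalar real,
  and unitarity leaves the two signs.\<close>

lemma sandwich_trivial:
  fixes A B :: "quat^2^2"
  assumes A: "A \<in> carrier Sp" and B: "B \<in> carrier Sp" and id: "\<And>v. A ** v ** adj B = v"
  shows "A = mat 1 \<and> B = mat 1 \<or> A = - mat 1 \<and> B = - mat 1"
proof -
  have "A ** adj B ** B = B" using id [of "mat 1"] by simp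
  then have AB: "A = B" using B by (simp add: Sp_simps)
  have com: "A ** v = v ** A" for v
  proof -
    have "A ** v ** adj B ** B = v ** B" by (simp add: id)
    then show ?thesis using B AB by (simp add: Sp_simps)
  qed
  obtain a b c d where m: "A = m2 a b c d" by (rule m2_cases)
  have "c = 0" "b = 0" using com [of "m2 1 0 0 0"] by (simp_all add: m m2_simps m2_eq_iff)
  have "a = d" using com [of "m2 0 1 0 0"] by (simp_all add: m m2_simps m2_eq_iff)
  have "a * x = x * a" for x using com [of "m2 x 0 0 0"] by (simp_all add: m m2_simps m2_eq_iff)
  then have a: "a = q0 a *\<^sub>R 1" by (rule quat_central)
  have "a * qcnj a = 1" using A \<open>b = 0\<close>
    by (simp add: carrier_Sp m m2_simps mat_m2 m2_eq_iff qcnj_simps)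
  then have "(q0 a *\<^sub>R 1) * qcnj (q0 a *\<^sub>R 1) = 1" using a by simp
  then have "q0 a * q0 a = 1" by (simp add: quat_eq_iff)
  then have "q0 a = 1 \<or> q0 a = - 1" by algebra
  then have "a = 1 \<or> a = -1" using a by (metis scaleR_minus_left scaleR_one)
  then show ?thesis
    using AB m \<open>b = 0\<close> \<open>c = 0\<close> \<open>a = d\<close> by (auto simp: mat_m2 m2_simps)
qed

section \<open>The Jordan algebra in components\<close>

lemma mat3_eq_iff:
  "(A :: 'a^3^3) = B \<longleftrightarrow>
     A$1$1 = B$1$1 \<and> A$1$2 = B$1$2 \<and> A$1$3 = B$1$3 \<and> A$2$1 = B$2$1 \<and> A$2$2 = B$2$2 \<and>
     A$2$3 = B$2$3 \<and> A$3$1 = B$3$1 \<and> A$3$2 = B$3$2 \<and> A$3$3 = B$3$3"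
  by (auto simp: vec_eq_iff forall_3)

definition cone :: cayley where "cone = (1, 0)"

text \<open>The arguments are the coordinates xi_1, xi_2, xi_3, x_1, x_2, x_3 in this order.\<close>

lift_definition mk :: "real \<Rightarrow> real \<Rightarrow> real \<Rightarrow> cayley \<Rightarrow> cayley \<Rightarrow> cayley \<Rightarrow> jordan" is
  "\<lambda>a b c x y z. vector [vector [a *\<^sub>R cone, z, ccnj y],
                          vector [ccnj z, b *\<^sub>R cone, x],
                          vector [y, ccnj x, c *\<^sub>R cone]]"
  by (simp add: mat3_eq_iff cadj_def ccnj_simps) (simp add: ccnj_def cone_def)

lemma ccnj_fixed: "ccnj x = x \<Longrightarrow> x = cRe x *\<^sub>R cone"
proof -
  assume "ccnj x = x"
  then have "qcnj (fst x) = fst x" "- snd x = snd x" by (auto simp: ccnj_def prod_eq_iff)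
  then have "q1 (fst x) = 0" "q2 (fst x) = 0" "q3 (fst x) = 0" "snd x = 0"
    by (auto simp: quat_eq_iff)
  then show ?thesis by (auto simp: cone_def prod_eq_iff cRe_def quat_eq_iff)
qed

lemma mk_cases: obtains a b c x y z where "X = mk a b c x y z"
proof -
  have "\<exists>a b c x y z. X = mk a b c x y z"
  proof (transfer, goal_cases)
    case (1 M)
    then have M: "ccnj (M$j$i) = M$i$j" for i j by (metis (no_types, lifting) cadj_def vec_lambda_beta)
    show ?case
      by (rule exI [of _ "cRe (M$1$1)"], rule exI [of _ "cRe (M$2$2)"], rule exI [of _ "cRe (M$3$3)"],
          rule exI [of _ "M$2$3"], rule exI [of _ "M$3$1"], rule exI [of _ "M$1$2"])
        (simp add: mat3_eq_iff M ccnj_fixed [symmetric])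
  qed
  then show thesis using that by blast
qed

lemma mk_eq_iff:
  "mk a b c x y z = mk a' b' c' x' y' z' \<longleftrightarrow>
     a = a' \<and> b = b' \<and> c = c' \<and> x = x' \<and> y = y' \<and> z = z'"
proof (transfer, goal_cases)
  case (1 a b c x y z a' b' c' x' y' z')
  have "r *\<^sub>R cone = s *\<^sub>R cone \<longleftrightarrow> r = s" for r s
    by (auto simp: cone_def prod_eq_iff quat_eq_iff)
  then show ?case unfolding mat3_eq_iff by (simp only: vector_3) blast
qed

lemma mk_linear:
  "mk a b c x y z + mk a' b' c' x' y' z' = mk (a + a') (b + b') (c + c') (x + x') (y + y') (z + z')"
  "mk a b c x y z - mk a' b' c' x' y' z' = mk (a - a') (b - b') (c - c') (x - x') (y - y') (z - z')"
  "- mk a b c x y z = mk (- a) (- b) (- c) (- x) (- y) (- z)"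
  "r *\<^sub>R mk a b c x y z = mk (r * a) (r * b) (r * c) (r *\<^sub>R x) (r *\<^sub>R y) (r *\<^sub>R z)"
  by (transfer; simp add: mat3_eq_iff ccnj_simps algebra_simps)+

lemma mk_zero: "0 = mk 0 0 0 0 0 0"
  by transfer (simp add: mat3_eq_iff ccnj_def zero_prod_def)

lemma mk_junit: "junit = mk 1 1 1 0 0 0"
  by transfer (simp add: mat3_eq_iff ccnj_def zero_prod_def cone_def)

lemma jtrace_mk: "jtrace (mk a b c x y z) = a + b + c"
  by transfer (simp add: sum_3 cRe_def cone_def)

lemma jgamma_mk:
  "jgamma (mk a b c x y z) =
     mk a b c (fst x, - snd x) (fst y, - snd y) (fst z, - snd z)"
  by transfer (simp add: mat3_eq_iff ccnj_def cone_def)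

lemma jsigma_mk: "jsigma (mk a b c x y z) = mk a b c x (- y) (- z)"
  by transfer (simp add: mat3_eq_iff ccnj_simps)

lemma cmul_linear:
  "(x + y) \<star> z = x \<star> z + y \<star> z" "z \<star> (x + y) = z \<star> x + z \<star> y"
  "(r *\<^sub>R x) \<star> z = r *\<^sub>R (x \<star> z)" "z \<star> (r *\<^sub>R x) = r *\<^sub>R (z \<star> x)"
  by (auto simp: cmul_def qcnj_simps algebra_simps split: prod.splits)

lemma cmul_cone: "cone \<star> x = x" "x \<star> cone = x" "ccnj cone = cone"
  by (auto simp: cone_def cmul_def ccnj_def qcnj_simps split: prod.splits)

lemma cmul_ccnj_polar:
  "x \<star> ccnj y + y \<star> ccnj x = (2 * inner x y) *\<^sub>R cone" "ccnj x \<star> y + ccnj y \<star> x = (2 * inner x y) *\<^sub>R cone"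
  by (auto simp: cone_def cmul_def ccnj_def inner_prod_def quat_eq_iff quat_sel_times inner_quat_def
      algebra_simps split: prod.splits)

lemma inner_cone:
  "inner x y *\<^sub>R cone = (1/2) *\<^sub>R (x \<star> ccnj y + y \<star> ccnj x)"
  "inner x y *\<^sub>R cone = (1/2) *\<^sub>R (ccnj x \<star> y + ccnj y \<star> x)"
  by (simp_all add: cmul_ccnj_polar)

lemma jprod_mk:
  "jprod (mk a b c x y z) (mk a' b' c' x' y' z') =
     mk (a * a' + inner y y' + inner z z') (b * b' + inner x x' + inner z z')
        (c * c' + inner x x' + inner y y')
        ((1/2) *\<^sub>R ((b + c) *\<^sub>R x' + (b' + c') *\<^sub>R x + ccnj (y \<star> z') + ccnj (y' \<star> z)))
        ((1/2) *\<^sub>R ((c + a) *\<^sub>R y' + (c' + a') *\<^sub>R y + ccnj (z \<star> x') + ccnj (z' \<star> x)))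
        ((1/2) *\<^sub>R ((a + b) *\<^sub>R z' + (a' + b') *\<^sub>R z + ccnj (x \<star> y') + ccnj (x' \<star> y)))"
proof (transfer, goal_cases)
  case (1 a b c x y z a' b' c' x' y' z')
  have half: "u = (1/2) *\<^sub>R (u + u)" for u :: cayley by (rule scaleR_half_double [symmetric])
  \<comment> \<open>Splits a diagonal entry evenly between the products XY and YX; the inner
    products enter through the polarization of x conj(x) = |x|^2.\<close>
  have diag: "(r * r' + inner u u' + inner w w') *\<^sub>R cone =
      (1/2) *\<^sub>R (((r * r') *\<^sub>R cone + w \<star> ccnj w' + ccnj u \<star> u') + ((r * r') *\<^sub>R cone + w' \<star> ccnj w + ccnj u' \<star> u))"
    for r r' :: real and u u' w w'
    unfolding scaleR_add_left inner_cone(2) [of u] inner_cone(1) [of w]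
    by (subst half [of "(r * r') *\<^sub>R cone"]) (simp only: scaleR_add_right add_ac)
  have diag2: "(b * b' + inner x x' + inner z z') *\<^sub>R cone = (b * b' + inner z z' + inner x x') *\<^sub>R cone"
    by (simp only: add.assoc add.commute [of "inner z z'"])
  show ?case
    unfolding mat3_eq_iff diag [of a a' y y' z z'] diag2 diag [of b b' z z' x x'] diag [of c c' x x' y y']
    by (simp only: cmatmul_def sum_3 vec_lambda_beta vector_3 plus_vec_def vector_scaleR_component
        ccnj_simps cmul_linear cmul_cone scaleR_scaleR)
      (intro conjI; simp only: scaleR_add_right scaleR_add_left add_ac mult.commute)
qed

section \<open>Trace form, cross product and determinant in coordinates\<close>

definition jform :: "jordan \<Rightarrow> jordan \<Rightarrow> real" where
  "jform X Y = jtrace (jprod X Y)"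

text \<open>The cross product of the real algebra: \<open>freudenthal\<close> is its complex
  bilinear extension, as \<open>jcform\<close> is that of \<open>jform\<close>.\<close>

definition jcross :: "jordan \<Rightarrow> jordan \<Rightarrow> jordan" where
  "jcross X Y = (1/2) *\<^sub>R (2 *\<^sub>R jprod X Y - jtrace X *\<^sub>R Y - jtrace Y *\<^sub>R X
     + (jtrace X * jtrace Y - jform X Y) *\<^sub>R junit)"

lemma jform_mk:
  "jform (mk a b c x y z) (mk a' b' c' x' y' z') =
     a * a' + b * b' + c * c' + 2 * (inner x x' + inner y y' + inner z z')"
  by (simp add: jform_def jprod_mk jtrace_mk)

lemma jcross_mk:
  "jcross (mk a b c x y z) (mk a' b' c' x' y' z') =
     mk ((b * c' + c * b') / 2 - inner x x') ((c * a' + a * c') / 2 - inner y y')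
        ((a * b' + b * a') / 2 - inner z z')
        ((1/2) *\<^sub>R (ccnj (y \<star> z') + ccnj (y' \<star> z) - a *\<^sub>R x' - a' *\<^sub>R x))
        ((1/2) *\<^sub>R (ccnj (z \<star> x') + ccnj (z' \<star> x) - b *\<^sub>R y' - b' *\<^sub>R y))
        ((1/2) *\<^sub>R (ccnj (x \<star> y') + ccnj (x' \<star> y) - c *\<^sub>R z' - c' *\<^sub>R z))"
  unfolding jcross_def jform_mk jprod_mk jtrace_mk mk_linear mk_junit mk_eq_iff
  by (simp add: field_simps scaleR_add_right scaleR_add_left scaleR_diff_right)

lemma jform_linear:
  "jform (X + Y) Z = jform X Z + jform Y Z" "jform Z (X + Y) = jform Z X + jform Z Y"
  "jform (X - Y) Z = jform X Z - jform Y Z" "jform Z (X - Y) = jform Z X - jform Z Y"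
  "jform (- X) Z = - jform X Z" "jform Z (- X) = - jform Z X"
  "jform (r *\<^sub>R X) Z = r * jform X Z" "jform Z (r *\<^sub>R X) = r * jform Z X"
  "jform 0 Z = 0" "jform Z 0 = 0"
  by (cases X rule: mk_cases; cases Y rule: mk_cases; cases Z rule: mk_cases;
      simp add: mk_linear mk_zero jform_mk inner_add_left inner_add_right inner_diff_left
        inner_diff_right algebra_simps)+

lemma jcross_linear:
  "jcross (X + Y) Z = jcross X Z + jcross Y Z" "jcross Z (X + Y) = jcross Z X + jcross Z Y"
  "jcross (r *\<^sub>R X) Z = r *\<^sub>R jcross X Z" "jcross Z (r *\<^sub>R X) = r *\<^sub>R jcross Z X"
  by (cases X rule: mk_cases; cases Y rule: mk_cases; cases Z rule: mk_cases;
      simp add: mk_linear jcross_mk mk_eq_iff inner_add_left inner_add_right cmul_linear ccnj_simps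
        scaleR_add_right scaleR_add_left scaleR_diff_right add_divide_distrib algebra_simps)+

lemma jcross_linear':
  "jcross (X - Y) Z = jcross X Z - jcross Y Z" "jcross Z (X - Y) = jcross Z X - jcross Z Y"
  "jcross (- X) Z = - jcross X Z" "jcross Z (- X) = - jcross Z X"
  using jcross_linear(1) [of X "(-1) *\<^sub>R Y" Z] jcross_linear(2) [of Z X "(-1) *\<^sub>R Y"]
    jcross_linear(3) [of "-1" X Z] jcross_linear(4) [of Z "-1" X]
    jcross_linear(3) [of "-1" Y Z] jcross_linear(4) [of Z "-1" Y]
  by simp_all

lemma jcform_pair:
  "jcform X Y = Complex (jform (fst X) (fst Y) - jform (snd X) (snd Y))
     (jform (fst X) (snd Y) + jform (snd X) (fst Y))"
proof -
  have "jtrace (A - B) = jtrace A - jtrace B" "jtrace (A + B) = jtrace A + jtrace B" for A B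
    by (cases A rule: mk_cases; cases B rule: mk_cases; simp add: mk_linear jtrace_mk)+
  then show ?thesis by (simp add: jcform_def jcprod_def jctrace_def jform_def)
qed

lemma freudenthal_pair:
  "freudenthal X Y = (jcross (fst X) (fst Y) - jcross (snd X) (snd Y),
     jcross (fst X) (snd Y) + jcross (snd X) (fst Y))"
  unfolding freudenthal_def jcform_pair
  by (cases X; cases Y)
    (simp add: cscale_def jcprod_def jctrace_def Eunit_def jcross_def algebra_simps)

lemma jcdet_pair:
  "jcdet (X, Y) = Complex
     ((jform X (jcross X X) - jform X (jcross Y Y) - jform Y (jcross X Y) - jform Y (jcross Y X)) / 3)
     ((jform X (jcross X Y) + jform X (jcross Y X) + jform Y (jcross X X) - jform Y (jcross Y Y)) / 3)"
  by (simp add: jcdet_def jcform_pair freudenthal_pair jform_linear complex_eq_iff)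

text \<open>A polynomial \<open>f\<close> of degree 3 is determined by \<open>f 0\<close>, \<open>f 1\<close>, \<open>f (-1)\<close> and its leading
  coefficient; this is its value at \<open>\<i>\<close>.\<close>

lemma jcdet_add_ii:
  "jcdet (X + \<i> *\<^sub>C Y) = 2 * jcdet X - (jcdet (X + Y) + jcdet (X - Y)) / 2
     + \<i> * ((jcdet (X + Y) - jcdet (X - Y)) / 2 - 2 * jcdet Y)"
  by (cases X; cases Y)
    (simp add: cscale_def jcdet_pair complex_eq_iff jform_linear jcross_linear jcross_linear' field_simps)

lemma jcherm_pair:
  "jcherm X Y = Complex (jform (fst X) (fst Y) + jform (snd X) (snd Y))
     (jform (fst X) (snd Y) - jform (snd X) (fst Y))"
  by (simp add: jcherm_def \<tau>_def jcform_pair jform_linear)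

section \<open>The real form fixed by \<open>\<tau>\<gamma>\<close>\<close>

text \<open>The tuple \<open>(t, (s, a\<^sub>1), (d, m\<^sub>1), v)\<close> stands for the element with diagonal
  \<open>t, s + d, s - d\<close> and \<open>x\<^sub>j = m\<^sub>j + i a\<^sub>j e\<^sub>4\<close>, where \<open>v\<close> has the rows \<open>a\<^sub>2, a\<^sub>3\<close> and
  \<open>m\<^sub>3, qcnj m\<^sub>2\<close>. In these coordinates \<open>\<sigma>\<close> becomes \<open>v \<mapsto> - v\<close>.\<close>

type_synonym mdl = "real \<times> (real \<times> quat) \<times> (real \<times> quat) \<times> (quat^2^2)"

definition hre :: "mdl \<Rightarrow> jordan" where
  "hre = (\<lambda>(t, p, r, v). mk t (fst p + fst r) (fst p - fst r) (snd r, 0) (qcnj (v$2$2), 0) (v$2$1, 0))"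

definition him :: "mdl \<Rightarrow> jordan" where
  "him = (\<lambda>(t, p, r, v). mk 0 0 0 (0, snd p) (0, v$1$1) (0, v$1$2))"

text \<open>\<open>(hre a, him a)\<close> is the point of the real form with coordinates
  \<open>a\<close>, and \<open>kap a b\<close> is a + ib. Thus pairs of coordinate tuples
  parametrize the whole complexified algebra.\<close>

definition kap :: "mdl \<Rightarrow> mdl \<Rightarrow> jordanC" where
  "kap a b = (hre a, him a) + \<i> *\<^sub>C (hre b, him b)"

definition flip :: "mdl \<Rightarrow> mdl" where
  "flip = (\<lambda>(t, p, r, v). (t, p, r, - v))"

definition cub :: "mdl \<Rightarrow> real" where
  "cub = (\<lambda>(t, p, r, v). t * (inner p p - inner r r) + inner (hm p ** v) v + inner (v ** hm r) v)"

definition nf :: "mdl \<Rightarrow> mdl \<Rightarrow> real" where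
  "nf = (\<lambda>(t, p, r, v) (t', p', r', v'). t * t' + 2 * inner p p' + 2 * inner r r' + 2 * inner v v')"

lemma linear_hre: "linear hre"
  by (rule linearI) (auto simp: hre_def mk_linear mk_eq_iff qcnj_simps algebra_simps)

lemma linear_him: "linear him"
  by (rule linearI) (auto simp: him_def mk_linear mk_eq_iff)

lemmas hre_simps = linear_add [OF linear_hre] linear_diff [OF linear_hre] linear_scale [OF linear_hre]
  linear_neg [OF linear_hre] linear_0 [OF linear_hre]
  and him_simps = linear_add [OF linear_him] linear_diff [OF linear_him] linear_scale [OF linear_him]
  linear_neg [OF linear_him] linear_0 [OF linear_him]

lemma kap_pair: "kap a b = (hre a - him b, him a + hre b)"
  by (simp add: kap_def cscale_def)

lemma kap_linear:
  "kap a b + kap a' b' = kap (a + a') (b + b')"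
  "c *\<^sub>C kap a b = kap (Re c *\<^sub>R a - Im c *\<^sub>R b) (Re c *\<^sub>R b + Im c *\<^sub>R a)"
  by (simp_all add: kap_pair cscale_def hre_simps him_simps algebra_simps)

lemma kap_split: "kap a b = kap a 0 + \<i> *\<^sub>C kap b 0"
  by (simp add: kap_linear)

lemma kap_cases: obtains a b where "X = kap a b"
proof -
  obtain a b c x y z where 1: "fst X = mk a b c x y z" by (rule mk_cases)
  obtain a' b' c' x' y' z' where 2: "snd X = mk a' b' c' x' y' z'" by (rule mk_cases)
  \<comment> \<open>The diagonal and the H-parts of the real half of \<open>X\<close> and the
    e_4-parts of its imaginary half go into the first tuple. The rest goes into the second one,
    where i * i = -1 reverses the sign of the e_4-parts.\<close>
  have "X = kap (a, ((b + c) / 2, snd x'), ((b - c) / 2, fst x), m2 (snd y') (snd z') (fst z) (qcnj (fst y)))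
     (a', ((b' + c') / 2, - snd x), ((b' - c') / 2, fst x'), m2 (- snd y) (- snd z) (fst z') (qcnj (fst y')))"
    by (simp add: prod_eq_iff 1 2 kap_pair hre_def him_def mk_linear mk_eq_iff qcnj_simps field_simps)
  then show thesis by (rule that)
qed

lemma kap_eq_iff: "kap a b = kap a' b' \<longleftrightarrow> a = a' \<and> b = b'"
proof
  have q: "qcnj x = qcnj y \<longleftrightarrow> x = y" for x y by (metis qcnj_simps(2))
  assume "kap a b = kap a' b'"
  then show "a = a' \<and> b = b'"
    by (cases a; cases b; cases a'; cases b')
      (auto simp: kap_pair hre_def him_def mk_linear mk_eq_iff q prod_eq_iff mat2_eq_iff)
qed simp

section \<open>Determinant, Hermitian form and involutions on the real form\<close>

definition ctri :: "cayley \<Rightarrow> cayley \<Rightarrow> cayley \<Rightarrow> real" where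
  "ctri x y z = inner x (ccnj (y \<star> z))"

text \<open>\<open>ctri x y z\<close> is the real part of x(yz). Its cyclic symmetry survives the
  lack of associativity and serves to collect the cubic terms of the determinant.\<close>

lemma ctri_cyclic: "ctri x y z = ctri z x y"
proof -
  obtain m a n b k c where "x = (m, a)" "y = (n, b)" "z = (k, c)" by (metis prod.exhaust)
  then show ?thesis
    by (simp add: ctri_def cmul_def ccnj_def inner_quat_def quat_sel_times algebra_simps)
qed

text \<open>An imaginary part with zero diagonal is the shape of the points
  \<open>(hre a, him a)\<close> of the real form.\<close>

lemma jcdet_offdiag:
  "jcdet (mk a b c x y z, mk 0 0 0 x' y' z') = Complex
     (a * b * c - a * (inner x x - inner x' x') - b * (inner y y - inner y' y') - c * (inner z z - inner z' z')
        + 2 * (ctri x y z - ctri x y' z' - ctri x' y z' - ctri x' y' z))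
     (2 * (ctri x' y z + ctri x y' z + ctri x y z' - ctri x' y' z'
        - a * inner x x' - b * inner y y' - c * inner z z'))"
proof -
  have cyc: "ctri z x y = ctri x y z" "ctri z x y' = ctri x y' z" "ctri z x' y = ctri x' y z"
    "ctri z x' y' = ctri x' y' z" "ctri z' x y = ctri x y z'" "ctri z' x y' = ctri x y' z'"
    "ctri z' x' y = ctri x' y z'" "ctri z' x' y' = ctri x' y' z'"
    "ctri y z x = ctri x y z" "ctri y z x' = ctri x' y z" "ctri y z' x = ctri x y z'"
    "ctri y z' x' = ctri x' y z'" "ctri y' z x = ctri x y' z" "ctri y' z x' = ctri x' y' z"
    "ctri y' z' x = ctri x y' z'" "ctri y' z' x' = ctri x' y' z'"
    by (metis ctri_cyclic)+
  have ctri: "inner u (ccnj (v \<star> w)) = ctri u v w" for u v w by (simp add: ctri_def)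
  show ?thesis
    unfolding jcdet_pair jcross_mk jform_mk
    by (simp add: inner_add_right inner_diff_right ctri cyc inner_commute [of x' x]
        inner_commute [of y' y] inner_commute [of z' z] complex_eq_iff) (simp add: field_simps)
qed

text \<open>The value is real because every term of the imaginary part contains an odd number of
  factors from H e_4, and a product with an odd number of them has real part 0.\<close>

lemma jcdet_iota: "jcdet (hre a, him a) = of_real (cub a)"
proof -
  obtain t s u d m v where a: "a = (t, (s, u), (d, m), v)" by (metis prod.exhaust)
  obtain v1 v2 v3 v4 where v: "v = m2 v1 v2 v3 v4" by (rule m2_cases)
  have "inner (u * v3) v1 = inner u (v1 * qcnj v3)" "inner (qcnj u * v1) v3 = inner u (v1 * qcnj v3)"
    "inner (u * v4) v2 = inner u (v2 * qcnj v4)" "inner (qcnj u * v2) v4 = inner u (v2 * qcnj v4)"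
    "inner (v2 * qcnj m) v1 = inner m (qcnj v1 * v2)" "inner (v1 * m) v2 = inner m (qcnj v1 * v2)"
    "inner (v4 * qcnj m) v3 = inner m (qcnj v3 * v4)" "inner (v3 * m) v4 = inner m (qcnj v3 * v4)"
    by (simp_all add: inner_quat_def quat_sel_times algebra_simps)
  moreover have "inner (qcnj x) (qcnj x) = inner x x" for x by (simp add: inner_quat_def)
  ultimately show ?thesis
    unfolding a v
    by (simp add: hre_def him_def jcdet_offdiag ctri_def cmul_def ccnj_def complex_eq_iff qcnj_simps
        cub_def hm_def m2_simps inner_m2 inner_add_left inner_diff_left)
      (simp add: algebra_simps)
qed

text \<open>Expresses the determinant through values of \<open>cub\<close> alone, so that a linear
  map preserving \<open>cub\<close> has a complexification preserving the determinant.\<close>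

lemma jcdet_kap: "jcdet (kap a b) = 
    Complex (2 * cub a - (cub (a + b) + cub (a - b)) / 2) ((cub (a + b) - cub (a - b)) / 2 - 2 * cub b)"
  unfolding kap_def jcdet_add_ii
  by (simp add: jcdet_iota hre_simps [symmetric] him_simps [symmetric] complex_eq_iff)

lemma jcherm_kap: "jcherm (kap a b) (kap a' b') = Complex (nf a a' + nf b b') (nf a b' - nf b a')"
proof -
  have 1: "jform (hre a) (hre b) + jform (him a) (him b) = nf a b" for a b
    by (cases a; cases b) (simp add: hre_def him_def nf_def jform_mk inner_m2 inner_prod_def inner_quat_def algebra_simps)
  have 2: "jform (hre a) (him b) = 0" "jform (him a) (hre b) = 0" for a b
    by (cases a; cases b; simp add: hre_def him_def jform_mk)+
  show ?thesis
    by (simp add: jcherm_pair kap_pair jform_linear 1 [symmetric] 2)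
qed

lemma jgamma_linear: "jgamma (X + Y) = jgamma X + jgamma Y" "jgamma (X - Y) = jgamma X - jgamma Y"
  by (cases X rule: mk_cases; cases Y rule: mk_cases; simp add: jgamma_mk mk_linear mk_eq_iff)+

lemma jgamma_hre: "jgamma (hre a) = hre a" "jgamma (him a) = - him a"
  by (cases a; simp add: hre_def him_def jgamma_mk mk_linear)+

text \<open>\<open>\<tau> \<circ> \<gamma>\<close> is the complex conjugation belonging to the real
  form, so a map commuting with it maps the real form to itself.\<close>

lemma tau_gamma_kap: "\<tau> (\<gamma> (kap a b)) = kap a (- b)" "\<gamma> (\<tau> (kap a b)) = kap a (- b)"
proof -
  have "jgamma (- X) = - jgamma X" for X by (cases X rule: mk_cases) (simp add: jgamma_mk mk_linear)
  then show "\<tau> (\<gamma> (kap a b)) = kap a (- b)" "\<gamma> (\<tau> (kap a b)) = kap a (- b)"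
    by (simp_all add: \<tau>_def \<gamma>_def kap_pair jgamma_linear jgamma_hre hre_simps him_simps)
qed

lemma sigma_kap: "\<sigma> (kap a b) = kap (flip a) (flip b)"
  by (cases a; cases b; simp add: \<sigma>_def kap_pair hre_def him_def mk_linear jsigma_mk mk_eq_iff flip_def
      qcnj_simps)

lemma linear_flip: "linear flip"
  by (rule linearI) (auto simp: flip_def)

lemma flip_flip [simp]: "flip (flip a) = a"
  by (cases a) (simp add: flip_def)

section \<open>Passage between maps of the real form and their complexifications\<close>

definition cplx :: "(mdl \<Rightarrow> mdl) \<Rightarrow> jordanC \<Rightarrow> jordanC" where
  "cplx \<beta> X = (case inv_into UNIV (case_prod kap) X of (a, b) \<Rightarrow> kap (\<beta> a) (\<beta> b))"

lemma cplx_kap: "cplx \<beta> (kap a b) = kap (\<beta> a) (\<beta> b)"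
proof -
  have "inj (case_prod kap)" by (auto intro!: injI simp: kap_eq_iff)
  then have "inv_into UNIV (case_prod kap) (case_prod kap (a, b)) = (a, b)" by (rule inv_f_f)
  then show ?thesis by (simp add: cplx_def)
qed

lemma cplx_comp: "cplx \<beta> \<circ> cplx \<beta>' = cplx (\<beta> \<circ> \<beta>')"
proof
  show "(cplx \<beta> \<circ> cplx \<beta>') X = cplx (\<beta> \<circ> \<beta>') X" for X
    by (cases X rule: kap_cases) (simp add: cplx_kap)
qed

lemma cplx_inject: "cplx \<beta> = cplx \<beta>' \<longleftrightarrow> \<beta> = \<beta>'"
proof
  assume "cplx \<beta> = cplx \<beta>'"
  then have "cplx \<beta> (kap a 0) = cplx \<beta>' (kap a 0)" for a by simp
  then show "\<beta> = \<beta>'" by (auto simp: cplx_kap kap_eq_iff)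
qed simp

text \<open>The admissible maps of the real form: by \<open>cplx_in_E6\<close> and
  \<open>E6_is_cplx\<close>, their complexifications are exactly the elements of both
  subgroups.\<close>

definition GN :: "(mdl \<Rightarrow> mdl) set" where
  "GN = {\<beta>. linear \<beta> \<and> (\<forall>x. cub (\<beta> x) = cub x) \<and> (\<forall>x y. nf (\<beta> x) (\<beta> y) = nf x y) \<and>
     (\<forall>x. \<beta> (flip x) = flip (\<beta> x))}"

lemma nf_definite: "nf x x = 0 \<longleftrightarrow> x = 0"
proof -
  obtain t p r v where x: "x = (t, p, r, v)" by (metis prod.exhaust)
  have "nf x x = t * t + 2 * inner p p + 2 * inner r r + 2 * inner v v" by (simp add: x nf_def)
  also have "\<dots> = 0 \<longleftrightarrow> t * t = 0 \<and> inner p p = 0 \<and> inner r r = 0 \<and> inner v v = 0"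
    using inner_ge_zero [of p] inner_ge_zero [of r] inner_ge_zero [of v] zero_le_square [of t]
    by linarith
  finally show ?thesis by (simp add: x zero_prod_def)
qed

lemma GN_bij:
  assumes "\<beta> \<in> GN"
  shows "bij \<beta>"
proof -
  have lin: "linear \<beta>" and nf: "\<And>x. nf (\<beta> x) (\<beta> x) = nf x x" using assms unfolding GN_def by blast+
  have inj: "inj \<beta>"
    unfolding linear_injective_0 [OF lin] by (metis nf nf_definite)
  then have "surj \<beta>" by (rule linear_inj_imp_surj [OF lin])
  with inj show ?thesis by (simp add: bij_def)
qed

lemma cplx_in_E6:
  assumes "\<beta> \<in> GN"
  shows "cplx \<beta> \<in> E6_lam_gamma \<inter> E6_lam_gamma_sigma"
proof -
  have lin: "linear \<beta>" and cub: "\<And>x. cub (\<beta> x) = cub x" and nf: "\<And>x y. nf (\<beta> x) (\<beta> y) = nf x y"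
    and flip: "\<And>x. \<beta> (flip x) = flip (\<beta> x)"
    using assms by (auto simp: GN_def)
  note lsimps = linear_add [OF lin, symmetric] linear_diff [OF lin, symmetric] linear_scale [OF lin, symmetric]
    linear_neg [OF lin, symmetric]
  have "Vector_Spaces.linear cscale cscale (cplx \<beta>)"
    unfolding Vector_Spaces.linear_iff
  proof (intro conjI vector_space_cscale allI)
    show "cplx \<beta> (X + Y) = cplx \<beta> X + cplx \<beta> Y" for X Y
      by (cases X rule: kap_cases; cases Y rule: kap_cases) (simp add: kap_linear cplx_kap lsimps)
    show "cplx \<beta> (c *\<^sub>C X) = c *\<^sub>C cplx \<beta> X" for c X
      by (cases X rule: kap_cases) (simp add: kap_linear cplx_kap lsimps)
  qed
  moreover have "bij (cplx \<beta>)"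
  proof (rule o_bij [of "cplx (inv_into UNIV \<beta>)"])
    have id: "cplx id = id" by (rule ext) (metis cplx_kap id_apply kap_cases)
    show "cplx (inv_into UNIV \<beta>) \<circ> cplx \<beta> = id" "cplx \<beta> \<circ> cplx (inv_into UNIV \<beta>) = id"
      using GN_bij [OF assms] by (simp_all add: cplx_comp id inj_iff surj_iff bij_def)
  qed
  moreover have "jcdet (cplx \<beta> X) = jcdet X" for X
    by (cases X rule: kap_cases) (simp add: cplx_kap jcdet_kap lsimps cub)
  moreover have "jcherm (cplx \<beta> X) (cplx \<beta> Y) = jcherm X Y" for X Y
    by (cases X rule: kap_cases; cases Y rule: kap_cases) (simp add: cplx_kap jcherm_kap nf)
  moreover have "lam (\<gamma> \<circ> cplx \<beta> \<circ> \<gamma>) = cplx \<beta>"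
  proof
    show "lam (\<gamma> \<circ> cplx \<beta> \<circ> \<gamma>) X = cplx \<beta> X" for X
      by (cases X rule: kap_cases) (simp add: lam_def cplx_kap tau_gamma_kap linear_neg [OF lin])
  qed
  moreover have "lam (\<gamma> \<circ> \<sigma> \<circ> cplx \<beta> \<circ> \<sigma> \<circ> \<gamma>) = cplx \<beta>"
  proof
    show "lam (\<gamma> \<circ> \<sigma> \<circ> cplx \<beta> \<circ> \<sigma> \<circ> \<gamma>) X = cplx \<beta> X" for X
      by (cases X rule: kap_cases)
        (simp add: lam_def cplx_kap tau_gamma_kap sigma_kap flip linear_neg [OF lin] linear_neg [OF linear_flip])
  qed
  ultimately show ?thesis by (simp add: E6_lam_gamma_def E6_lam_gamma_sigma_def E6_def)
qed

text \<open>The first condition says that \<open>\<alpha>\<close> commutes with the conjugation of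
  the real form and hence restricts to it. Given this, the second one says that the restriction
  commutes with \<open>flip\<close>.\<close>

lemma E6_is_cplx:
  assumes \<alpha>: "\<alpha> \<in> E6_lam_gamma \<inter> E6_lam_gamma_sigma"
  obtains \<beta> where "\<beta> \<in> GN" "\<alpha> = cplx \<beta>"
proof -
  have add: "\<And>X Y. \<alpha> (X + Y) = \<alpha> X + \<alpha> Y" and scale: "\<And>c X. \<alpha> (c *\<^sub>C X) = c *\<^sub>C \<alpha> X"
    and det: "\<And>X. jcdet (\<alpha> X) = jcdet X" and herm: "\<And>X Y. jcherm (\<alpha> X) (\<alpha> Y) = jcherm X Y"
    and g: "\<And>X. lam (\<gamma> \<circ> \<alpha> \<circ> \<gamma>) X = \<alpha> X" and gs: "\<And>X. lam (\<gamma> \<circ> \<sigma> \<circ> \<alpha> \<circ> \<sigma> \<circ> \<gamma>) X = \<alpha> X"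
    using \<alpha> by (auto simp: E6_lam_gamma_def E6_lam_gamma_sigma_def E6_def Vector_Spaces.linear_iff)
  have "\<exists>c. \<alpha> (kap a 0) = kap c 0" for a
  proof -
    obtain c d where cd: "\<alpha> (kap a 0) = kap c d" by (rule kap_cases)
    have "kap c (- d) = kap c d" using g [of "kap a 0"] by (simp add: lam_def tau_gamma_kap cd)
    then have "- d = d" by (simp add: kap_eq_iff)
    then have "2 *\<^sub>R d = 0" unfolding scaleR_2 by (metis add.left_inverse)
    then have "d = 0" by simp
    with cd show ?thesis by blast
  qed
  then obtain \<beta> where \<beta>: "\<And>a. \<alpha> (kap a 0) = kap (\<beta> a) 0" by metis
  have "linear \<beta>"
  proof (rule linearI)
    show "\<beta> (a + b) = \<beta> a + \<beta> b" for a b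
      using add [of "kap a 0" "kap b 0"] by (simp add: kap_linear \<beta> kap_eq_iff)
    show "\<beta> (r *\<^sub>R a) = r *\<^sub>R \<beta> a" for r a
      using scale [of "of_real r" "kap a 0"] by (simp add: kap_linear \<beta> kap_eq_iff)
  qed
  moreover have "cub (\<beta> a) = cub a" for a
    using det [of "kap a 0"] by (simp add: \<beta> jcdet_kap)
  moreover have "nf (\<beta> a) (\<beta> b) = nf a b" for a b
  proof -
    have "nf 0 0 = 0" by (simp add: nf_definite)
    then show ?thesis using herm [of "kap a 0" "kap b 0"] by (simp add: \<beta> jcherm_kap)
  qed
  moreover have "\<beta> (flip a) = flip (\<beta> a)" for a
  proof -
    have f0: "flip 0 = 0" by (rule linear_0 [OF linear_flip])
    have "kap (flip (\<beta> (flip a))) 0 = kap (\<beta> a) 0"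
      using gs [of "kap a 0"] by (simp add: lam_def tau_gamma_kap sigma_kap f0 \<beta>)
    then show ?thesis by (metis flip_flip kap_eq_iff)
  qed
  ultimately have "\<beta> \<in> GN" by (simp add: GN_def)
  moreover have "\<alpha> = cplx \<beta>"
  proof
    show "\<alpha> X = cplx \<beta> X" for X
    proof (cases X rule: kap_cases)
      case (1 a b)
      have "\<alpha> X = \<alpha> (kap a 0) + \<i> *\<^sub>C \<alpha> (kap b 0)" by (simp only: 1 kap_split [of a b] add scale)
      also have "\<dots> = kap (\<beta> a) (\<beta> b)" by (simp only: \<beta> kap_split [symmetric])
      finally show ?thesis by (simp add: 1 cplx_kap)
    qed
  qed
  ultimately show thesis by (rule that)
qed

section \<open>The linear group of the real form\<close>

definition act :: "sp2pair \<Rightarrow> mdl \<Rightarrow> mdl" where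
  "act = (\<lambda>(A, B) (t, p, r, v).
     (t, unhm (A ** hm p ** adj A), unhm (B ** hm r ** adj B), A ** v ** adj B))"

text \<open>The sign of \<open>t\<close> compensates for exchanging \<open>p\<close> and
  \<open>r\<close> in |p|^2 - |r|^2, and \<open>adj\<close> turns left multiplication by
  \<open>hm p\<close> into right multiplication.\<close>

definition swp :: "mdl \<Rightarrow> mdl" where
  "swp = (\<lambda>(t, p, r, v). (- t, r, p, adj v))"

lemma carrier_Sp2xSp2: "carrier Sp2xSp2 = carrier Sp \<times> carrier Sp"
  by (simp add: Sp2xSp2_def)

lemma mult_Sp2xSp2: "(A, B) \<otimes>\<^bsub>Sp2xSp2\<^esub> (A', B') = (A ** A', B ** B')"
  by (simp add: Sp2xSp2_def Sp_def)

lemma inner_unhm_conj: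
  assumes "A \<in> carrier Sp"
  shows "inner (unhm (A ** hm p ** adj A)) (unhm (A ** hm q ** adj A)) = inner p q"
proof -
  have "2 * inner (unhm (A ** hm p ** adj A)) (unhm (A ** hm q ** adj A)) = 2 * inner p q"
    using assms by (simp only: inner_hm [symmetric] hm_conj inner_sandwich)
  then show ?thesis by simp
qed

lemma inner_adj: "inner (adj v) (adj w) = inner v w" for v w :: "quat^2^2"
  by (simp add: inner_m2 adj_def inner_quat_def)

lemma act_in_GN:
  assumes "x \<in> carrier Sp2xSp2"
  shows "act x \<in> GN"
proof -
  obtain A B where x: "x = (A, B)" and A: "A \<in> carrier Sp" and B: "B \<in> carrier Sp"
    using assms by (auto simp: carrier_Sp2xSp2)
  have "linear (act x)"
    by (rule linearI) (simp_all add: x act_def case_prod_beta hm_simps quatmat_distrib quatmat_scale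
        linear_add [OF linear_unhm] linear_scale [OF linear_unhm])
  moreover have "cub (act x (t, p, r, v)) = cub (t, p, r, v)" for t p r v
  proof -
    have "A ** hm p ** adj A ** (A ** v ** adj B) = A ** (hm p ** v) ** adj B"
      using A by (simp add: matrix_mul_assoc Sp_simps)
    moreover have "A ** v ** adj B ** (B ** hm r ** adj B) = A ** (v ** hm r) ** adj B"
      using B by (simp add: matrix_mul_assoc Sp_simps)
    ultimately show ?thesis
      using A B by (simp add: x act_def cub_def hm_conj inner_unhm_conj inner_sandwich)
  qed
  moreover have "nf (act x (t, p, r, v)) (act x (t', p', r', v')) = nf (t, p, r, v) (t', p', r', v')"
    for t p r v t' p' r' v'
    using A B by (simp add: x act_def nf_def inner_unhm_conj inner_sandwich)
  moreover have "act x (flip (t, p, r, v)) = flip (act x (t, p, r, v))" for t p r v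
    by (simp add: x act_def flip_def quatmat_minus)
  ultimately show ?thesis by (simp add: GN_def split_paired_all)
qed

lemma swp_in_GN: "swp \<in> GN"
proof -
  have "linear swp"
    by (rule linearI) (auto simp: swp_def adj_simps)
  moreover have "cub (swp (t, p, r, v)) = cub (t, p, r, v)" for t p r v
  proof -
    have "inner (hm r ** adj v) (adj v) = inner (v ** hm r) v"
      using inner_adj [of "v ** hm r" v] by (simp add: adj_simps hm_simps)
    moreover have "inner (adj v ** hm p) (adj v) = inner (hm p ** v) v"
      using inner_adj [of "hm p ** v" v] by (simp add: adj_simps hm_simps)
    ultimately show ?thesis by (simp add: swp_def cub_def algebra_simps)
  qed
  moreover have "nf (swp (t, p, r, v)) (swp (t', p', r', v')) = nf (t, p, r, v) (t', p', r', v')"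
    for t p r v t' p' r' v'
    by (simp add: swp_def nf_def inner_adj)
  moreover have "swp (flip (t, p, r, v)) = flip (swp (t, p, r, v))" for t p r v
    by (simp add: swp_def flip_def adj_simps)
  ultimately show ?thesis by (simp add: GN_def split_paired_all)
qed

lemma GN_comp: "\<beta> \<in> GN \<Longrightarrow> \<beta>' \<in> GN \<Longrightarrow> \<beta> \<circ> \<beta>' \<in> GN"
  unfolding GN_def by (simp add: linear_compose del: split_paired_All)

lemma act_comp:
  assumes "x \<in> carrier Sp2xSp2" "y \<in> carrier Sp2xSp2"
  shows "act x \<circ> act y = act (x \<otimes>\<^bsub>Sp2xSp2\<^esub> y)"
proof -
  obtain A B where x: "x = (A, B)" using prod.exhaust by blast
  obtain A' B' where y: "y = (A', B')" and "A' \<in> carrier Sp" "B' \<in> carrier Sp"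
    using assms by (auto simp: carrier_Sp2xSp2)
  then show ?thesis
    by (auto simp: x y mult_Sp2xSp2 act_def hm_conj adj_simps matrix_mul_assoc)
qed

lemma swp_swp: "swp \<circ> swp = id"
  by (auto simp: swp_def adj_simps)

text \<open>\<open>adj\<close> reverses the order of the factors in \<open>A ** v ** adj B\<close>.
  This is the origin of the action of \<open>rho\<close> in the semidirect product.\<close>

lemma swp_act: "swp \<circ> act x = act (rho x) \<circ> swp"
  by (cases x) (auto simp: swp_def act_def rho_def adj_simps matrix_mul_assoc)

lemma act_uminus: "act (- A, - B) = act (A, B)"
  by (auto simp: act_def adj_simps quatmat_minus)

text \<open>The component \<open>v\<close> alone determines the pair up to a common sign:
  \<open>sandwich_trivial\<close> applies to \<open>adj A' ** A\<close> and
  \<open>adj B' ** B\<close>.\<close>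

lemma act_eq_iff:
  assumes x: "(A, B) \<in> carrier Sp2xSp2" and y: "(A', B') \<in> carrier Sp2xSp2"
  shows "act (A, B) = act (A', B') \<longleftrightarrow> A = A' \<and> B = B' \<or> A = - A' \<and> B = - B'"
proof
  have S: "A \<in> carrier Sp" "B \<in> carrier Sp" "A' \<in> carrier Sp" "B' \<in> carrier Sp"
    using x y by (auto simp: carrier_Sp2xSp2)
  assume "act (A, B) = act (A', B')"
  then have "act (A, B) (0, 0, 0, v) = act (A', B') (0, 0, 0, v)" for v by simp
  then have eq: "A ** v ** adj B = A' ** v ** adj B'" for v by (simp add: act_def)
  have "adj A' ** A ** v ** adj (adj B' ** B) = v" for v
  proof -
    have "adj A' ** A ** v ** adj (adj B' ** B) = adj A' ** (A ** v ** adj B) ** B'"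
      by (simp add: adj_simps matrix_mul_assoc)
    then show ?thesis using S by (simp add: eq matrix_mul_assoc Sp_simps)
  qed
  then have "adj A' ** A = mat 1 \<and> adj B' ** B = mat 1 \<or> adj A' ** A = - mat 1 \<and> adj B' ** B = - mat 1"
    using S by (intro sandwich_trivial Sp_mult Sp_adj)
  moreover have "A = A' ** (adj A' ** A)" "B = B' ** (adj B' ** B)" using S by (simp_all add: Sp_simps)
  ultimately show "A = A' \<and> B = B' \<or> A = - A' \<and> B = - B'" by (auto simp: quatmat_minus)
next
  assume "A = A' \<and> B = B' \<or> A = - A' \<and> B = - B'"
  then show "act (A, B) = act (A', B')" using act_uminus by auto
qed

text \<open>The sign on the \<open>t\<close> axis separates the two cosets.\<close>

lemma act_neq_act_swp: "act x \<noteq> act y \<circ> swp"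
proof
  assume "act x = act y \<circ> swp"
  then have "act x (1, 0, 0, 0) = act y (swp (1, 0, 0, 0))" by simp
  then show False by (cases x; cases y) (simp add: act_def swp_def)
qed

section \<open>Every admissible map comes from Sp(2) x Sp(2), up to the swap\<close>

lemma orthogonal_intertwiner:
  fixes g :: "'a :: real_inner \<Rightarrow> 'a"
  assumes "linear g" "surj g" "linear L" "linear M"
    and orth: "\<And>v w. inner (g v) (g w) = inner v w"
    and L: "\<And>v w. inner (L v) w = inner v (L w)" and M: "\<And>v w. inner (M v) w = inner v (M w)"
    and eq: "\<And>v. inner (M (g v)) (g v) = inner (L v) v"
  shows "M (g v) = g (L v)"
proof -
  have "inner (M (g v)) (g w) = inner (L v) w" for w
  proof -
    \<comment> \<open>Polarization: \<open>eq\<close> at \<open>v + w\<close> expands into these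
      terms because \<open>L\<close> and \<open>M\<close> are symmetric, and \<open>eq\<close> at
      \<open>v\<close> and at \<open>w\<close> cancels the pure ones.\<close>
    have "inner (M (g v)) (g v) + 2 * inner (M (g v)) (g w) + inner (M (g w)) (g w)
        = inner (L v) v + 2 * inner (L v) w + inner (L w) w"
      using eq [of "v + w"] L [of w v] M [of "g w" "g v"]
      by (simp add: linear_add [OF assms(1)] linear_add [OF assms(3)] linear_add [OF assms(4)]
          inner_add_left inner_add_right inner_commute)
    then show ?thesis by (simp add: eq)
  qed
  then have "inner (M (g v) - g (L v)) (g w) = 0" for w by (simp add: inner_diff_left orth)
  \<comment> \<open>As \<open>g\<close> is surjective, \<open>g w\<close> may be chosen to be the
    difference vector itself.\<close>
  then have "inner (M (g v) - g (L v)) (M (g v) - g (L v)) = 0" by (metis assms(2) surjD)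
  then show ?thesis by simp
qed

lemma flip_eq_iff: "flip x = x \<longleftrightarrow> snd (snd (snd x)) = 0"
  "flip x = - x \<longleftrightarrow> fst x = 0 \<and> fst (snd x) = 0 \<and> fst (snd (snd x)) = 0"
proof -
  have neg: "- v = v \<longleftrightarrow> v = 0" "v = - v \<longleftrightarrow> v = 0" for v :: "'b :: real_vector"
    by (metis add.inverse_neutral add.left_inverse scaleR_2 scaleR_eq_0_iff zero_neq_numeral)+
  show "flip x = x \<longleftrightarrow> snd (snd (snd x)) = 0"
    "flip x = - x \<longleftrightarrow> fst x = 0 \<and> fst (snd x) = 0 \<and> fst (snd (snd x)) = 0"
    by (cases x; simp add: flip_def neg)+
qed

text \<open>The vectors (0, 0, 0, v) form the eigenspace of \<open>flip\<close> for -1, which a map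
  commuting with \<open>flip\<close> preserves; on it \<open>nf\<close> is twice the inner
  product.\<close>

lemma GN_odd_part:
  assumes "\<beta> \<in> GN"
  obtains g where "linear g" "surj g" "\<And>v w. inner (g v) (g w) = inner v w"
    "\<And>v. \<beta> (0, 0, 0, v) = (0, 0, 0, g v)"
proof -
  have lin: "linear \<beta>" and nf: "\<And>x y. nf (\<beta> x) (\<beta> y) = nf x y"
    and flip: "\<And>x. \<beta> (flip x) = flip (\<beta> x)"
    using assms unfolding GN_def by blast+
  define g where "g v = snd (snd (snd (\<beta> (0, 0, 0, v))))" for v
  have g: "\<beta> (0, 0, 0, v) = (0, 0, 0, g v)" for v
  proof -
    have "flip (\<beta> (0, 0, 0, v)) = - \<beta> (0, 0, 0, v)"
      unfolding flip [symmetric] linear_neg [OF lin, symmetric] by (simp add: flip_def)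
    then show ?thesis unfolding flip_eq_iff by (simp add: prod_eq_iff g_def)
  qed
  have "linear g"
  proof (rule linearI)
    show "g (v + w) = g v + g w" for v w
      using linear_add [OF lin, of "(0, 0, 0, v)" "(0, 0, 0, w)"] by (simp add: g)
    show "g (c *\<^sub>R v) = c *\<^sub>R g v" for c v
      using linear_scale [OF lin, of c "(0, 0, 0, v)"] by (simp add: g)
  qed
  moreover have orth: "inner (g v) (g w) = inner v w" for v w
    using nf [of "(0, 0, 0, v)" "(0, 0, 0, w)"] by (simp add: g nf_def)
  moreover have "surj g"
  proof -
    have "inj g" unfolding linear_injective_0 [OF \<open>linear g\<close>] by (metis inner_eq_zero_iff orth)
    then show ?thesis by (rule linear_inj_imp_surj [OF \<open>linear g\<close>])
  qed
  ultimately show thesis using that g by blast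
qed

text \<open>The coordinate axis of \<open>t\<close> consists of the even \<open>x\<close> for which \<open>cub (x + v)\<close> does not depend
  on the odd \<open>v\<close>.\<close>

lemma GN_axis:
  assumes "\<beta> \<in> GN"
  shows "\<beta> (1, 0, 0, 0) = (1, 0, 0, 0) \<or> \<beta> (1, 0, 0, 0) = (- 1, 0, 0, 0)"
proof -
  have lin: "linear \<beta>" and cub: "\<And>x. cub (\<beta> x) = cub x" and nf: "\<And>x y. nf (\<beta> x) (\<beta> y) = nf x y"
    and flip: "\<And>x. \<beta> (flip x) = flip (\<beta> x)"
    using assms unfolding GN_def by blast+
  obtain g where "linear g" and g: "surj g" and "\<And>v w. inner (g v) (g w) = inner v w"
    and odd: "\<And>v. \<beta> (0, 0, 0, v) = (0, 0, 0, g v)"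
    using GN_odd_part [OF assms] by blast
  obtain t p r w where e: "\<beta> (1, 0, 0, 0) = (t, p, r, w)" by (metis prod.exhaust)
  have "flip (\<beta> (1, 0, 0, 0)) = \<beta> (1, 0, 0, 0)" unfolding flip [symmetric] by (simp add: flip_def)
  then have w: "w = 0" unfolding flip_eq_iff e by simp
  \<comment> \<open>\<open>cub\<close> vanishes at all (1, 0, 0, v'), and surjectivity of
    \<open>g\<close> lets the odd component of the image be arbitrary.\<close>
  have c: "cub (t, p, r, v) = 0" for v
  proof -
    obtain v' where v': "v = g v'" using g by (rule surjE)
    have "\<beta> (1, 0, 0, v') = \<beta> (1, 0, 0, 0) + \<beta> (0, 0, 0, v')"
      by (simp add: linear_add [OF lin, symmetric])
    then have "\<beta> (1, 0, 0, v') = (t, p, r, v)" by (simp add: e odd w v')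
    then show ?thesis using cub [of "(1, 0, 0, v')"] by (simp add: cub_def hm_simps)
  qed
  have q: "inner (hm p ** v) v + inner (v ** hm r) v = 0" for v
    using c [of v] c [of 0] by (auto simp: cub_def)
  obtain s u where p: "p = (s, u)" by (cases p)
  obtain d m where r: "r = (d, m)" by (cases r)
  have 11: "inner (1 :: quat) 1 = 1" by (simp add: inner_quat_def)
  \<comment> \<open>Evaluating the vanishing quadratic form at two matrix units gives s + d and s -
    d; afterwards \<open>m2 u 0 1 0\<close> and \<open>m2 1 m 0 0\<close> give 2|u|^2 and
    2|m|^2.\<close>
  have "s + d = 0" using q [of "m2 1 0 0 0"] by (simp add: p r hm_def m2_simps inner_m2 11)
  moreover have "s - d = 0" using q [of "m2 0 1 0 0"] by (simp add: p r hm_def m2_simps inner_m2 11)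
  ultimately have sd: "s = 0" "d = 0" by simp_all
  have qq: "inner (qcnj x * x) 1 = inner x x" "inner (x * qcnj x) 1 = inner x x" for x
    by (simp_all add: inner_quat_def quat_sel_times)
  have "inner u u = 0" using q [of "m2 u 0 1 0"] by (simp add: p r sd hm_def m2_simps inner_m2 qq)
  moreover have "inner m m = 0" using q [of "m2 1 m 0 0"] by (simp add: p r sd hm_def m2_simps inner_m2 qq)
  ultimately have pr: "p = 0" "r = 0" by (simp_all add: p r sd zero_prod_def)
  have "t * t = 1" using nf [of "(1, 0, 0, 0)" "(1, 0, 0, 0)"] by (simp add: nf_def e pr w)
  then have "t = 1 \<or> t = - 1" by algebra
  then show ?thesis by (auto simp: e pr w)
qed

text \<open>With the axis fixed, \<open>nf\<close> and \<open>cub\<close> split the rest of the even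
  part into two copies of R^5, and the remaining cubic terms make the odd part intertwine Clifford
  multiplication on both sides. \<open>clifford_isometry_sandwich\<close> then yields the
  pair.\<close>

lemma GN_fixing_axis:
  assumes "\<beta> \<in> GN" and e: "\<beta> (1, 0, 0, 0) = (1, 0, 0, 0)"
  obtains x where "x \<in> carrier Sp2xSp2" "\<beta> = act x"
proof -
  have lin: "linear \<beta>" and cub: "\<And>x. cub (\<beta> x) = cub x" and nf: "\<And>x y. nf (\<beta> x) (\<beta> y) = nf x y"
    and flip: "\<And>x. \<beta> (flip x) = flip (\<beta> x)"
    using assms unfolding GN_def by blast+
  obtain g where g: "linear g" "surj g" "\<And>v w. inner (g v) (g w) = inner v w"
    "\<And>v. \<beta> (0, 0, 0, v) = (0, 0, 0, g v)"
    using GN_odd_part [OF assms(1)] by blast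
  have even: "\<exists>p' r'. \<beta> (0, p, r, 0) = (0, p', r', 0) \<and> inner p' p' = inner p p \<and> inner r' r' = inner r r" for p r
  proof -
    obtain t' p' r' v' where 1: "\<beta> (0, p, r, 0) = (t', p', r', v')" by (metis prod.exhaust)
    have "flip (\<beta> (0, p, r, 0)) = \<beta> (0, p, r, 0)" unfolding flip [symmetric] by (simp add: flip_def)
    then have v': "v' = 0" unfolding flip_eq_iff 1 by simp
    have t': "t' = 0" using nf [of "(0, p, r, 0)" "(1, 0, 0, 0)"] by (simp add: 1 e nf_def)
    have "\<beta> (1, p, r, 0) = \<beta> (1, 0, 0, 0) + \<beta> (0, p, r, 0)" by (simp add: linear_add [OF lin, symmetric])
    \<comment> \<open>At t = 1 and v = 0, \<open>cub\<close> is the difference of the squared norms;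
      \<open>nf\<close> supplies their sum.\<close>
    then have "inner p' p' - inner r' r' = inner p p - inner r r"
      using cub [of "(1, p, r, 0)"] by (simp add: e 1 t' v' cub_def)
    moreover have "inner p' p' + inner r' r' = inner p p + inner r r"
      using nf [of "(0, p, r, 0)" "(0, p, r, 0)"] by (simp add: 1 t' v' nf_def)
    ultimately have "inner p' p' = inner p p" "inner r' r' = inner r r" by linarith+
    then show ?thesis using 1 t' v' by blast
  qed
  have "\<exists>p'. \<beta> (0, p, 0, 0) = (0, p', 0, 0)" for p
    using even [of p 0] by (metis inner_eq_zero_iff inner_zero_left)
  then obtain b1 where b1: "\<And>p. \<beta> (0, p, 0, 0) = (0, b1 p, 0, 0)" by metis
  have "\<exists>r'. \<beta> (0, 0, r, 0) = (0, 0, r', 0)" for r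
    using even [of 0 r] by (metis inner_eq_zero_iff inner_zero_left)
  then obtain b2 where b2: "\<And>r. \<beta> (0, 0, r, 0) = (0, 0, b2 r, 0)" by metis
  have \<beta>: "\<beta> (t, p, r, v) = (t, b1 p, b2 r, g v)" for t p r v
  proof -
    have "(t, p, r, v) = t *\<^sub>R (1, 0, 0, 0) + ((0, p, 0, 0) + ((0, 0, r, 0) + (0, 0, 0, v)))" by simp
    then have "\<beta> (t, p, r, v) = t *\<^sub>R (1, 0, 0, 0) + ((0, b1 p, 0, 0) + ((0, 0, b2 r, 0) + (0, 0, 0, g v)))"
      by (simp only: linear_add [OF lin] linear_scale [OF lin] e b1 b2 g)
    then show ?thesis by simp
  qed
  have b0: "b1 0 = 0" "b2 0 = 0" using b1 [of 0] b2 [of 0] linear_0 [OF lin] by (auto simp: zero_prod_def)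
  have mult_linear: "linear (\<lambda>v :: quat^2^2. hm p ** v)" "linear (\<lambda>v :: quat^2^2. v ** hm p)" for p
    using linear_sandwich [of "hm p" "mat 1"] linear_sandwich [of "mat 1" "hm p"] by simp_all
  have left: "g (hm p ** v) = hm (b1 p) ** g v" for p v
  proof (rule orthogonal_intertwiner [OF g(1,2) mult_linear(1) [of p] mult_linear(1) [of "b1 p"], symmetric])
    show "inner (g v) (g w) = inner v w" for v w by (rule g)
    show "inner (hm p ** v) w = inner v (hm p ** w)" for v w :: "quat^2^2" by (simp add: inner_quatmat_times hm_simps)
    show "inner (hm (b1 p) ** g v) (g v) = inner (hm p ** v) v" for v
      using cub [of "(0, p, 0, v)"] by (simp add: \<beta> cub_def b0 hm_simps)
  qed (simp add: inner_quatmat_times hm_simps)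
  have right: "g (v ** hm p) = g v ** hm (b2 p)" for p v
  proof (rule orthogonal_intertwiner [OF g(1,2) mult_linear(2) [of p] mult_linear(2) [of "b2 p"], symmetric])
    show "inner (g v) (g w) = inner v w" for v w by (rule g)
    show "inner (v ** hm p) w = inner v (w ** hm p)" for v w :: "quat^2^2"
      by (simp add: inner_quatmat_times_right hm_simps)
    show "inner (g v ** hm (b2 p)) (g v) = inner (v ** hm p) v" for v
      using cub [of "(0, 0, p, v)"] by (simp add: \<beta> cub_def b0 hm_simps)
  qed (simp add: inner_quatmat_times_right hm_simps)
  have norm: "norm (g v) = norm v" for v by (simp add: norm_eq_sqrt_inner g)
  obtain A B where AB: "A \<in> carrier Sp" "B \<in> carrier Sp" "\<And>v. g v = A ** v ** adj B"
    using clifford_isometry_sandwich [OF g(1) norm left right] by blast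
  \<comment> \<open>At this preimage of the identity the intertwining laws become formulas for
    \<open>hm (b1 p)\<close> and \<open>hm (b2 p)\<close>.\<close>
  have one: "g (adj A ** B) = mat 1"
    using AB by (simp add: matrix_mul_assoc Sp_simps)
  have "hm (b1 p) = A ** hm p ** adj A" for p
  proof -
    have "hm (b1 p) = g (hm p ** (adj A ** B))" by (simp only: left one quatmat_one)
    also have "\<dots> = A ** hm p ** adj A" using AB by (simp add: matrix_mul_assoc Sp_simps)
    finally show ?thesis .
  qed
  then have 1: "b1 p = unhm (A ** hm p ** adj A)" for p by (metis unhm_hm)
  have "hm (b2 p) = B ** hm p ** adj B" for p
  proof -
    have "hm (b2 p) = g (adj A ** B ** hm p)" by (simp only: right one quatmat_one)
    also have "\<dots> = B ** hm p ** adj B" using AB by (simp add: matrix_mul_assoc Sp_simps)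
    finally show ?thesis .
  qed
  then have 2: "b2 p = unhm (B ** hm p ** adj B)" for p by (metis unhm_hm)
  show thesis
  proof
    show "(A, B) \<in> carrier Sp2xSp2" using AB by (simp add: carrier_Sp2xSp2)
    show "\<beta> = act (A, B)" by (auto simp: \<beta> act_def 1 2 AB)
  qed
qed

text \<open>\<open>swp\<close> reverses the axis, so composing with it reduces the case of sign -1
  to \<open>GN_fixing_axis\<close>.\<close>

lemma GN_cases:
  assumes "\<beta> \<in> GN"
  obtains x where "x \<in> carrier Sp2xSp2" "\<beta> = act x"
    | x where "x \<in> carrier Sp2xSp2" "\<beta> = act x \<circ> swp"
proof (cases "\<beta> (1, 0, 0, 0) = (1, 0, 0, 0)")
  case True
  then show thesis using GN_fixing_axis [OF assms] that by blast
next
  case False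
  then have e: "\<beta> (1, 0, 0, 0) = (- 1, 0, 0, 0)" using GN_axis [OF assms] by blast
  have lin: "linear \<beta>" using assms by (simp add: GN_def)
  have "(\<beta> \<circ> swp) (1, 0, 0, 0) = \<beta> (- (1, 0, 0, 0))"
    by (simp add: swp_def) (simp add: adj_def zero_vec_def)
  also have "\<dots> = (1, 0, 0, 0)" by (simp only: linear_neg [OF lin] e) simp
  finally obtain x where x: "x \<in> carrier Sp2xSp2" "\<beta> \<circ> swp = act x"
    using GN_fixing_axis [OF GN_comp [OF assms swp_in_GN]] by blast
  have "\<beta> = \<beta> \<circ> swp \<circ> swp" by (simp add: comp_assoc swp_swp)
  then show thesis using that x by metis
qed

section \<open>The isomorphism\<close>

definition act2 :: "sp2pair \<Rightarrow> (sp2pair \<Rightarrow> sp2pair) \<Rightarrow> mdl \<Rightarrow> mdl" where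
  "act2 x h = act x \<circ> (if h = id then id else swp)"

definition real_iso :: "sp2pair \<Rightarrow> (sp2pair \<Rightarrow> sp2pair) \<Rightarrow> jordanC \<Rightarrow> jordanC" where
  "real_iso x h = cplx (act2 x h)"

lemma rho_neq_id: "rho \<noteq> id"
proof
  assume "rho = id"
  then have "rho (0, mat 1) = (0, mat 1)" by simp
  then show False by (simp add: rho_def mat_m2 m2_eq_iff)
qed

lemma rho_rho: "rho \<circ> rho = id"
  by (auto simp: rho_def)

lemma coset_Z2: "Z2 #>\<^bsub>Sp2xSp2\<^esub> (A, B) = {(A, B), (- A, - B)}"
  by (auto simp: r_coset_def Z2_def mult_Sp2xSp2 quatmat_minus)

lemma real_iso_in_E6:
  assumes "x \<in> carrier Sp2xSp2"
  shows "real_iso x h \<in> E6_lam_gamma \<inter> E6_lam_gamma_sigma"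
proof -
  have "act x \<circ> id \<in> GN" "act x \<circ> swp \<in> GN"
    using act_in_GN [OF assms] swp_in_GN GN_comp by auto
  then show ?thesis unfolding real_iso_def act2_def by (intro cplx_in_E6) auto
qed

lemma real_iso_surj:
  assumes "\<alpha> \<in> E6_lam_gamma \<inter> E6_lam_gamma_sigma"
  obtains x h where "x \<in> carrier Sp2xSp2" "h \<in> {id, rho}" "\<alpha> = real_iso x h"
proof -
  obtain \<beta> where \<beta>: "\<beta> \<in> GN" "\<alpha> = cplx \<beta>" using E6_is_cplx [OF assms] by blast
  from \<beta>(1) show thesis
  proof (cases rule: GN_cases)
    case (1 x)
    then have "\<alpha> = real_iso x id" by (simp add: \<beta> real_iso_def act2_def)
    with 1 show thesis using that by blast
  next
    case (2 x)
    then have "\<alpha> = real_iso x rho" by (simp add: \<beta> real_iso_def act2_def rho_neq_id)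
    with 2 show thesis using that by blast
  qed
qed

lemma real_iso_eq_iff:
  assumes "x \<in> carrier Sp2xSp2" "y \<in> carrier Sp2xSp2" "h \<in> {id, rho}" "k \<in> {id, rho}"
  shows "real_iso x h = real_iso y k \<longleftrightarrow> h = k \<and> x \<in> Z2 #>\<^bsub>Sp2xSp2\<^esub> y"
proof -
  obtain A B A' B' where xy: "x = (A, B)" "y = (A', B')" by (metis prod.exhaust)
  have cancel: "act x \<circ> swp = act y \<circ> swp \<longleftrightarrow> act x = act y"
  proof
    assume "act x \<circ> swp = act y \<circ> swp"
    then have "act x \<circ> (swp \<circ> swp) = act y \<circ> (swp \<circ> swp)" by (simp only: comp_assoc [symmetric])
    then show "act x = act y" by (simp add: swp_swp)
  qed simp
  have "act x = act y \<longleftrightarrow> x \<in> Z2 #>\<^bsub>Sp2xSp2\<^esub> y"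
    using act_eq_iff [OF assms(1,2) [unfolded xy]] by (simp add: xy coset_Z2)
  then show ?thesis
    using assms(3,4) rho_neq_id act_neq_act_swp [of x y] act_neq_act_swp [of y x]
    by (auto simp: real_iso_def act2_def cplx_inject cancel)
qed

text \<open>Moving \<open>swp\<close> past \<open>act y\<close> replaces \<open>y\<close> by
  \<open>rho y\<close>, which is precisely the twist in the semidirect multiplication.\<close>

lemma real_iso_comp:
  assumes "x \<in> carrier Sp2xSp2" "y \<in> carrier Sp2xSp2" "h \<in> {id, rho}" "k \<in> {id, rho}"
  shows "real_iso x h \<circ> real_iso y k = real_iso (x \<otimes>\<^bsub>Sp2xSp2\<^esub> h y) (h \<circ> k)"
proof -
  have rho: "rho y \<in> carrier Sp2xSp2" using assms(2) by (auto simp: carrier_Sp2xSp2 rho_def)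
  have "act x \<circ> swp \<circ> act y = act x \<circ> act (rho y) \<circ> swp" by (simp only: comp_assoc swp_act)
  then have "act x \<circ> swp \<circ> act y = act (x \<otimes>\<^bsub>Sp2xSp2\<^esub> rho y) \<circ> swp"
    by (simp only: act_comp [OF assms(1) rho])
  moreover have "act x \<circ> act y = act (x \<otimes>\<^bsub>Sp2xSp2\<^esub> y)" using act_comp assms(1,2) by blast
  ultimately have "act2 x h \<circ> act2 y k = act2 (x \<otimes>\<^bsub>Sp2xSp2\<^esub> h y) (h \<circ> k)"
    using assms(3,4) rho_neq_id rho_rho
    by (auto simp: act2_def comp_assoc [symmetric]) (simp_all add: comp_assoc swp_swp)
  then show ?thesis by (simp add: real_iso_def cplx_comp)
qed

text \<open>The fibre of \<open>\<lambda>x. real_iso x h\<close> over \<open>\<alpha>\<close> is already a coset of \<open>Z2\<close>.\<close>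

definition e6_iso :: "(jordanC \<Rightarrow> jordanC) \<Rightarrow> sp2pair set \<times> (sp2pair \<Rightarrow> sp2pair)" where
  "e6_iso \<alpha> = (let h = (if \<exists>x \<in> carrier Sp2xSp2. \<alpha> = real_iso x id then id else rho)
     in ({x \<in> carrier Sp2xSp2. \<alpha> = real_iso x h}, h))"

lemma coset_subset: "x \<in> carrier Sp2xSp2 \<Longrightarrow> Z2 #>\<^bsub>Sp2xSp2\<^esub> x \<subseteq> carrier Sp2xSp2"
  by (cases x) (auto simp: coset_Z2 carrier_Sp2xSp2 Sp_one_uminus)

lemma e6_iso_real_iso:
  assumes "x \<in> carrier Sp2xSp2" "h \<in> {id, rho}"
  shows "e6_iso (real_iso x h) = (Z2 #>\<^bsub>Sp2xSp2\<^esub> x, h)"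
proof -
  have ex: "(\<exists>y \<in> carrier Sp2xSp2. real_iso x h = real_iso y id) \<longleftrightarrow> h = id"
    using assms by (metis insertI1 real_iso_eq_iff)
  have "real_iso x h = real_iso y h \<longleftrightarrow> y \<in> Z2 #>\<^bsub>Sp2xSp2\<^esub> x" if "y \<in> carrier Sp2xSp2" for y
    using real_iso_eq_iff [OF that assms(1) assms(2) assms(2)] by metis
  then have fibre: "{y \<in> carrier Sp2xSp2. real_iso x h = real_iso y h} = Z2 #>\<^bsub>Sp2xSp2\<^esub> x"
    using coset_subset [OF assms(1)] by blast
  have h: "(if h = id then id else rho) = h" using assms(2) by auto
  show ?thesis unfolding e6_iso_def Let_def ex h fibre ..
qed

lemma target_carrier:
  "carrier target_group = ((\<lambda>x. Z2 #>\<^bsub>Sp2xSp2\<^esub> x) ` carrier Sp2xSp2) \<times> {id, rho}"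
  by (auto simp: target_group_def semidirect_prod_def comp_group_def FactGroup_def RCOSETS_def)

text \<open>Negating both components commutes with \<open>rho\<close>, so the image of a coset under
  \<open>h\<close> is again a coset; the signs are central, so coset products are computed on
  representatives.\<close>

lemma target_mult:
  assumes "x \<in> carrier Sp2xSp2" "y \<in> carrier Sp2xSp2" "h \<in> {id, rho}" "k \<in> {id, rho}"
  shows "(Z2 #>\<^bsub>Sp2xSp2\<^esub> x, h) \<otimes>\<^bsub>target_group\<^esub> (Z2 #>\<^bsub>Sp2xSp2\<^esub> y, k)
    = (Z2 #>\<^bsub>Sp2xSp2\<^esub> (x \<otimes>\<^bsub>Sp2xSp2\<^esub> h y), h \<circ> k)"
proof -
  have "h ` (Z2 #>\<^bsub>Sp2xSp2\<^esub> y) = Z2 #>\<^bsub>Sp2xSp2\<^esub> h y"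
    using assms(3) by (cases y) (auto simp: coset_Z2 rho_def)
  moreover have "(Z2 #>\<^bsub>Sp2xSp2\<^esub> x) <#>\<^bsub>Sp2xSp2\<^esub> (Z2 #>\<^bsub>Sp2xSp2\<^esub> z) = Z2 #>\<^bsub>Sp2xSp2\<^esub> (x \<otimes>\<^bsub>Sp2xSp2\<^esub> z)" for z
    by (cases x; cases z) (simp add: set_mult_def coset_Z2 mult_Sp2xSp2 quatmat_minus insert_commute)
  ultimately show ?thesis
    by (simp add: target_group_def semidirect_prod_def comp_group_def FactGroup_def)
qed

lemma e6_iso_is_iso:
  "e6_iso \<in> iso (comp_group (E6_lam_gamma \<inter> E6_lam_gamma_sigma)) target_group"
proof -
  let ?G = "E6_lam_gamma \<inter> E6_lam_gamma_sigma"
  have "e6_iso \<alpha> \<in> carrier target_group" if \<alpha>: "\<alpha> \<in> ?G" for \<alpha>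
  proof -
    obtain x h where "x \<in> carrier Sp2xSp2" "h \<in> {id, rho}" "\<alpha> = real_iso x h"
      using real_iso_surj [OF \<alpha>] by blast
    then show ?thesis by (simp add: e6_iso_real_iso target_carrier)
  qed
  moreover have "e6_iso (\<alpha> \<circ> \<beta>) = e6_iso \<alpha> \<otimes>\<^bsub>target_group\<^esub> e6_iso \<beta>"
    if \<alpha>: "\<alpha> \<in> ?G" and \<beta>: "\<beta> \<in> ?G" for \<alpha> \<beta>
  proof -
    obtain x h where x: "x \<in> carrier Sp2xSp2" "h \<in> {id, rho}" "\<alpha> = real_iso x h"
      using real_iso_surj [OF \<alpha>] by blast
    obtain y k where y: "y \<in> carrier Sp2xSp2" "k \<in> {id, rho}" "\<beta> = real_iso y k"
      using real_iso_surj [OF \<beta>] by blast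
    have "x \<otimes>\<^bsub>Sp2xSp2\<^esub> h y \<in> carrier Sp2xSp2"
      using x(1,2) y(1) by (cases x; cases y) (auto simp: carrier_Sp2xSp2 mult_Sp2xSp2 rho_def Sp_mult)
    moreover have "h \<circ> k \<in> {id, rho}" using x(2) y(2) rho_rho by auto
    ultimately show ?thesis
      unfolding x(3) y(3) real_iso_comp [OF x(1) y(1) x(2) y(2)]
      by (simp only: e6_iso_real_iso x(1,2) y(1,2) target_mult)
  qed
  moreover have "inj_on e6_iso ?G"
  proof (rule inj_onI)
    fix \<alpha> \<beta> assume \<alpha>: "\<alpha> \<in> ?G" and \<beta>: "\<beta> \<in> ?G" and eq: "e6_iso \<alpha> = e6_iso \<beta>"
    obtain x h where x: "x \<in> carrier Sp2xSp2" "h \<in> {id, rho}" "\<alpha> = real_iso x h"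
      using real_iso_surj [OF \<alpha>] by blast
    obtain y k where y: "y \<in> carrier Sp2xSp2" "k \<in> {id, rho}" "\<beta> = real_iso y k"
      using real_iso_surj [OF \<beta>] by blast
    have "Z2 #>\<^bsub>Sp2xSp2\<^esub> x = Z2 #>\<^bsub>Sp2xSp2\<^esub> y" "h = k"
      using eq e6_iso_real_iso [OF x(1,2)] e6_iso_real_iso [OF y(1,2)] x(3) y(3) by auto
    moreover have "x \<in> Z2 #>\<^bsub>Sp2xSp2\<^esub> x" by (cases x) (simp add: coset_Z2)
    ultimately show "\<alpha> = \<beta>" using x y real_iso_eq_iff by metis
  qed
  moreover have "e6_iso ` ?G = carrier target_group"
  proof
    show "e6_iso ` ?G \<subseteq> carrier target_group" using calculation(1) by blast
    show "carrier target_group \<subseteq> e6_iso ` ?G"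
    proof
      fix Y assume "Y \<in> carrier target_group"
      then obtain x h where x: "x \<in> carrier Sp2xSp2" "h \<in> {id, rho}" "Y = (Z2 #>\<^bsub>Sp2xSp2\<^esub> x, h)"
        unfolding target_carrier by blast
      then have "Y = e6_iso (real_iso x h)" by (simp only: e6_iso_real_iso)
      then show "Y \<in> e6_iso ` ?G" using real_iso_in_E6 [OF x(1)] by blast
    qed
  qed
  ultimately show ?thesis by (auto simp: iso_def hom_def bij_betw_def comp_group_def)
qed


section \<open>The homeomorphism\<close>

lemma continuous_on_quatmat_mult [continuous_intros]:
  fixes f :: "'a :: topological_space \<Rightarrow> quat^'n^'m" and g :: "'a \<Rightarrow> quat^'k^'n"
  assumes "continuous_on S f" "continuous_on S g"
  shows "continuous_on S (\<lambda>x. f x ** g x)"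
  unfolding matrix_matrix_mult_def
  by (intro continuous_on_vec_lambda continuous_on_sum continuous_on_mult
      continuous_on_component [OF continuous_on_component] assms)

lemma continuous_on_adj [continuous_intros]:
  fixes f :: "'a :: topological_space \<Rightarrow> quat^'n^'m"
  assumes "continuous_on S f"
  shows "continuous_on S (\<lambda>x. adj (f x))"
  unfolding adj_def
  by (intro continuous_on_vec_lambda continuous_on_qcnj continuous_on_component assms)

lemma compact_Sp2: "compact (carrier (Sp :: (quat^2^2) monoid))"
proof -
  have "carrier (Sp :: (quat^2^2) monoid) = {A. A ** adj A = mat 1}"
    by (auto simp: carrier_Sp)
  moreover have "closed {A :: quat^2^2. A ** adj A = mat 1}"
    by (intro closed_Collect_eq continuous_intros)
  \<comment> \<open>\<open>A\<close> is the sandwich of the identity by \<open>A\<close> and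
    \<open>mat 1\<close>, and sandwiches are isometries.\<close>
  moreover have "norm A = norm (mat 1 :: quat^2^2)" if "A \<in> carrier Sp" for A :: "quat^2^2"
    using inner_sandwich [OF that Sp_one_uminus(1), of "mat 1" "mat 1"]
    by (simp add: adj_simps norm_eq_sqrt_inner)
  then have "bounded (carrier (Sp :: (quat^2^2) monoid))"
    by (auto simp: bounded_iff)
  ultimately show ?thesis by (simp add: compact_eq_bounded_closed)
qed

lemma continuous_on_linear_comp:
  fixes f :: "'a :: euclidean_space \<Rightarrow> 'b :: real_normed_vector"
  assumes "linear f" "continuous_on S g"
  shows "continuous_on S (\<lambda>x. f (g x))"
  using assms by (simp add: bounded_linear.continuous_on linear_conv_bounded_linear)

lemma continuous_on_act: "continuous_on S (\<lambda>x. act x a)"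
proof -
  obtain t p r v where a: "a = (t, p, r, v)" by (metis prod.exhaust)
  have "continuous_on S (\<lambda>x. (t, unhm (fst x ** hm p ** adj (fst x)), unhm (snd x ** hm r ** adj (snd x)),
      fst x ** v ** adj (snd x)))"
    by (intro continuous_intros continuous_on_linear_comp [OF linear_unhm])
  then show ?thesis by (simp add: act_def a case_prod_beta)
qed

text \<open>In the topology of pointwise convergence it suffices to evaluate at each fixed
  \<open>X\<close>.\<close>

lemma continuous_on_real_iso: "continuous_on S (\<lambda>x. real_iso x h)"
proof (rule continuous_on_coordinatewise_then_product)
  fix X
  obtain a b where X: "X = kap a b" by (rule kap_cases)
  define j where "j = (if h = id then id else swp)"
  have "continuous_on S (\<lambda>x. (hre (act x (j a)) - him (act x (j b)), him (act x (j a)) + hre (act x (j b))))"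
    by (intro continuous_intros continuous_on_linear_comp [OF linear_hre]
        continuous_on_linear_comp [OF linear_him] continuous_on_act)
  then show "continuous_on S (\<lambda>x. real_iso x h X)"
    unfolding X real_iso_def cplx_kap unfolding act2_def kap_pair j_def comp_def .
qed

section \<open>Compactness of the target and the comparison of topologies\<close>

lemma topspace_quotient_topology: "topspace (quotient_topology T q) = q ` topspace T"
proof -
  have "{x \<in> topspace T. q x \<in> q ` topspace T} = topspace T" by auto
  then have "openin (quotient_topology T q) (q ` topspace T)" by (simp add: openin_quotient_topology)
  then show ?thesis
    using openin_quotient_topology [of T q "topspace (quotient_topology T q)"] openin_subset by blast
qed

lemma compact_space_quotient_topology:
  assumes "compact_space T"
  shows "compact_space (quotient_topology T q)"
proof -
  have "continuous_map T (quotient_topology T q) q"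
    by (auto simp: continuous_map_def topspace_quotient_topology openin_quotient_topology)
  then have "compactin (quotient_topology T q) (q ` topspace T)"
    using assms by (intro image_compactin) (auto simp: compact_space_def)
  then show ?thesis by (simp add: compact_space_def topspace_quotient_topology)
qed

lemma topspace_target: "topspace target_topology = carrier target_group"
  by (simp add: target_topology_def target_carrier topspace_quotient_topology)

lemma compact_space_target: "compact_space target_topology"
proof -
  have "compact (carrier Sp2xSp2)" by (simp add: carrier_Sp2xSp2 compact_Times compact_Sp2)
  then show ?thesis
    unfolding target_topology_def
    by (simp add: compact_space_prod_topology compact_space_quotient_topology compact_space_subtopology
        compact_space_discrete_topology)
qed

lemma Hausdorff_space_maps: "Hausdorff_space (top_of_set (S :: ('a \<Rightarrow> 'b :: metric_space) set))"
proof -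
  have "Hausdorff_space (product_topology (\<lambda>_ :: 'a. euclidean :: 'b topology) UNIV)"
    unfolding Hausdorff_space_product_topology by (simp add: Hausdorff_space_euclidean)
  then show ?thesis by (simp add: euclidean_product_topology Hausdorff_space_subtopology)
qed

text \<open>Continuity is accessible for the inverse \<open>F\<close>, which on each sheet descends
  from \<open>\<lambda>x. real_iso x h\<close>. Compactness of its domain and the Hausdorff property
  of the group of maps then give the homeomorphism.\<close>

lemma homeomorphic_map_e6_iso:
  "homeomorphic_map (top_of_set (E6_lam_gamma \<inter> E6_lam_gamma_sigma)) target_topology e6_iso"
proof -
  let ?G = "E6_lam_gamma \<inter> E6_lam_gamma_sigma"
  let ?q = "\<lambda>x. Z2 #>\<^bsub>Sp2xSp2\<^esub> x"
  have bij: "bij_betw e6_iso ?G (carrier target_group)"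
    using e6_iso_is_iso by (simp add: iso_def comp_group_def)
  define F where "F = inv_into ?G e6_iso"
  have F: "F (?q x, h) = real_iso x h" if "x \<in> carrier Sp2xSp2" "h \<in> {id, rho}" for x h
    unfolding F_def using that bij e6_iso_real_iso real_iso_in_E6
    by (metis bij_betw_inv_into_left)
  have Fbij: "bij_betw F (carrier target_group) ?G" unfolding F_def using bij by (rule bij_betw_inv_into)
  have "continuous_map target_topology (top_of_set ?G) F"
    unfolding continuous_map_def
  proof (intro conjI allI impI)
    show "F \<in> topspace target_topology \<rightarrow> topspace (top_of_set ?G)"
      using Fbij by (auto simp: topspace_target bij_betw_def)
    fix U assume U: "openin (top_of_set ?G) U"
    \<comment> \<open>The slice over \<open>h\<close> of the preimage of \<open>U\<close>. It is
      open in the quotient because its pullback to pairs is the preimage of \<open>U\<close> under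
      \<open>\<lambda>x. real_iso x h\<close>.\<close>
    define V where "V h = {S \<in> ?q ` carrier Sp2xSp2. F (S, h) \<in> U}" for h
    have "openin target_topology (V h \<times> {h})" if h: "h \<in> {id, rho}" for h
    proof -
      have "{x \<in> carrier Sp2xSp2. ?q x \<in> V h} = {x \<in> carrier Sp2xSp2. real_iso x h \<in> U}"
        using F h by (auto simp: V_def)
      moreover have "continuous_map (top_of_set (carrier Sp2xSp2)) (top_of_set ?G) (\<lambda>x. real_iso x h)"
        using continuous_on_real_iso real_iso_in_E6 by (auto simp: continuous_map_in_subtopology)
      from openin_continuous_map_preimage [OF this U]
      have "openin (top_of_set (carrier Sp2xSp2)) {x \<in> carrier Sp2xSp2. real_iso x h \<in> U}" by simp
      ultimately have "openin (top_of_set (carrier Sp2xSp2)) {x \<in> carrier Sp2xSp2. ?q x \<in> V h}"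
        by (simp only:)
      then have "openin (quotient_topology (top_of_set (carrier Sp2xSp2)) ?q) (V h)"
        by (auto simp: openin_quotient_topology V_def)
      then show ?thesis using h by (simp add: target_topology_def openin_prod_Times_iff)
    qed
    then have "openin target_topology (\<Union>h \<in> {id, rho}. V h \<times> {h})" by blast
    moreover have "{y \<in> topspace target_topology. F y \<in> U} = (\<Union>h \<in> {id, rho}. V h \<times> {h})"
      by (auto simp: topspace_target target_carrier V_def)
    ultimately show "openin target_topology {y \<in> topspace target_topology. F y \<in> U}" by simp
  qed
  then have "homeomorphic_map target_topology (top_of_set ?G) F"
    using Fbij by (intro continuous_imp_homeomorphic_map compact_space_target Hausdorff_space_maps)
      (auto simp: topspace_target bij_betw_def)
  then obtain g where g: "homeomorphic_maps target_topology (top_of_set ?G) F g"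
    by (auto simp: homeomorphic_map_maps)
  \<comment> \<open>\<open>F\<close> is the inverse of \<open>e6_iso\<close> on the group, so its
    topological inverse \<open>g\<close> agrees with \<open>e6_iso\<close> there, which is enough
    for the transfer.\<close>
  have "g \<alpha> = e6_iso \<alpha>" if "\<alpha> \<in> ?G" for \<alpha>
  proof -
    have "e6_iso \<alpha> \<in> topspace target_topology" using bij that by (auto simp: topspace_target bij_betw_def)
    then have "g (F (e6_iso \<alpha>)) = e6_iso \<alpha>" using g by (simp add: homeomorphic_maps_def)
    then show ?thesis using bij that by (simp add: F_def bij_betw_inv_into_left)
  qed
  moreover have "homeomorphic_map (top_of_set ?G) target_topology g"
    using g by (simp add: homeomorphic_maps_map)
  ultimately show ?thesis by (auto intro: homeomorphic_map_eq)
qed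

theorem theorem4p6p4:
  shows "\<exists>f \<in> iso (comp_group (E6_lam_gamma \<inter> E6_lam_gamma_sigma)) target_group.
           homeomorphic_map (top_of_set (E6_lam_gamma \<inter> E6_lam_gamma_sigma)) target_topology f"
  using e6_iso_is_iso homeomorphic_map_e6_iso by blast

end
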